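(* Let $X$ be an irreducible nondegenerate variety in $\mathbb{P}^N$ over an algebraically closed field of characteristic zero, and let $g$ be the generic rank with respect to $X$. For every $k \geq 1$, $\operatorname{codim} W_{g+k} \geq 2k-1$.
   Context: The rank of a point $p\in\mathbb{P}^N$ with respect to $X$ is the least $r$ such that $p$ lies in the linear span of some $r$ distinct points of $X$; $W_j$ is the Zariski closure of the set of points of rank exactly $j$; the generic rank $g$ is the rank attained on a dense open subset of $\mathbb{P}^N$. *)

theory Defs
  imports "HOL-Computational_Algebra.Polynomial" "HOL-Library.Extended_Nat"
begin

text \<open>Projective space P^N over a field 'k, with N + 1 = CARD('n).
  A point of P^N is represented by any nonzero homogeneous coordinate vector
  v :: 'n => 'k; subsets of P^N are represented by cones of nonzero vectors.
  Polynomials in the coordinates are finitely supported coefficient functions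
  on monomial exponent vectors 'n => nat.\<close>

definition is_hpoly :: "(('n::finite \<Rightarrow> nat) \<Rightarrow> 'k::field) \<Rightarrow> bool" where
  "is_hpoly c \<longleftrightarrow> finite {m. c m \<noteq> 0} \<and>
     (\<exists>d. \<forall>m. c m \<noteq> 0 \<longrightarrow> (\<Sum>i\<in>UNIV. m i) = d)"

definition peval :: "(('n::finite \<Rightarrow> nat) \<Rightarrow> 'k::field) \<Rightarrow> ('n \<Rightarrow> 'k) \<Rightarrow> 'k" where
  "peval c v = (\<Sum>m\<in>{m. c m \<noteq> 0}. c m * (\<Prod>i\<in>UNIV. v i ^ m i))"

definition pts :: "('n::finite \<Rightarrow> 'k::field) set" where
  "pts = {v. v \<noteq> (\<lambda>_. 0)}"

definition zclosed :: "('n::finite \<Rightarrow> 'k::field) set \<Rightarrow> bool" where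
  "zclosed Z \<longleftrightarrow> (\<exists>F. (\<forall>f\<in>F. is_hpoly f) \<and>
      Z = {v. v \<noteq> (\<lambda>_. 0) \<and> (\<forall>f\<in>F. peval f v = 0)})"

definition zclosure :: "('n::finite \<Rightarrow> 'k::field) set \<Rightarrow> ('n \<Rightarrow> 'k) set" where
  "zclosure S = \<Inter>{Z. zclosed Z \<and> S \<subseteq> Z}"

definition zopen :: "('n::finite \<Rightarrow> 'k::field) set \<Rightarrow> bool" where
  "zopen U \<longleftrightarrow> U \<subseteq> pts \<and> zclosed (pts - U)"

definition zirreducible :: "('n::finite \<Rightarrow> 'k::field) set \<Rightarrow> bool" where
  "zirreducible Z \<longleftrightarrow> zclosed Z \<and> Z \<noteq> {} \<and>
     (\<forall>A B. zclosed A \<and> zclosed B \<and> Z \<subseteq> A \<union> B \<longrightarrow> Z \<subseteq> A \<or> Z \<subseteq> B)"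

definition proj_dim :: "('n::finite \<Rightarrow> 'k::field) set \<Rightarrow> nat" where
  "proj_dim Z = Sup {n. \<exists>C :: nat \<Rightarrow> ('n \<Rightarrow> 'k) set.
       (\<forall>i\<le>n. zirreducible (C i) \<and> C i \<subseteq> Z) \<and> (\<forall>i<n. C i \<subset> C (Suc i))}"

definition proj_codim :: "('n::finite \<Rightarrow> 'k::field) set \<Rightarrow> enat" where
  "proj_codim Z = (if Z = {} then \<infinity> else enat (card (UNIV :: 'n set) - 1 - proj_dim Z))"

definition proj_eq :: "('n \<Rightarrow> 'k::field) \<Rightarrow> ('n \<Rightarrow> 'k) \<Rightarrow> bool" where
  "proj_eq v w \<longleftrightarrow> (\<exists>c. c \<noteq> 0 \<and> v = (\<lambda>i. c * w i))"

definition in_span_of :: "('n \<Rightarrow> 'k::field) set \<Rightarrow> nat \<Rightarrow> ('n \<Rightarrow> 'k) \<Rightarrow> bool" where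
  "in_span_of X r p \<longleftrightarrow> (\<exists>x :: nat \<Rightarrow> ('n \<Rightarrow> 'k).
      (\<forall>j<r. x j \<in> X) \<and> (\<forall>j<r. \<forall>l<r. j \<noteq> l \<longrightarrow> \<not> proj_eq (x j) (x l)) \<and>
      (\<exists>a :: nat \<Rightarrow> 'k. p = (\<lambda>i. \<Sum>j<r. a j * x j i)))"

definition rank :: "('n \<Rightarrow> 'k::field) set \<Rightarrow> ('n \<Rightarrow> 'k) \<Rightarrow> nat" where
  "rank X p = (LEAST r. in_span_of X r p)"

definition W :: "('n::finite \<Rightarrow> 'k::field) set \<Rightarrow> nat \<Rightarrow> ('n \<Rightarrow> 'k) set" where
  "W X j = zclosure {p \<in> pts. rank X p = j}"

definition generic_rank :: "('n::finite \<Rightarrow> 'k::field) set \<Rightarrow> nat" where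
  "generic_rank X = (THE g. \<exists>U. zopen U \<and> U \<noteq> {} \<and> zclosure U = pts \<and>
       (\<forall>p\<in>U. rank X p = g))"

definition nondegenerate :: "('n::finite \<Rightarrow> 'k::field) set \<Rightarrow> bool" where
  "nondegenerate X \<longleftrightarrow> (\<forall>a :: 'n \<Rightarrow> 'k. a \<noteq> (\<lambda>_. 0) \<longrightarrow> (\<exists>x\<in>X. (\<Sum>i\<in>UNIV. a i * x i) \<noteq> 0))"

end

theory Submission
  imports Defs "HOL-Library.Function_Algebras" "HOL-Library.Set_Algebras" "HOL-Library.FuncSet"
begin

text \<open>Everything is done with affine cones, whose closed sets are the zero sets of arbitrary
  polynomial functions. Let \<open>V\<close> be a maximal irreducible closed set in which the points of rank \<open>m\<close>
  are dense, where \<open>m\<close> exceeds the generic rank. A general point of the join of \<open>V\<close> and \<open>X\<close> has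
  rank \<open>m - 1\<close>, \<open>m\<close> or \<open>m + 1\<close>, and maximality together with a downward induction on \<open>m\<close> leaves
  only \<open>m - 1\<close>. Hence the join of \<open>W X m\<close> and \<open>X\<close> lies in \<open>W X (m - 1)\<close>. Moreover, an irreducible
  closed set whose join with \<open>X\<close> is not the whole space is separated from this join by a further
  irreducible closed set, because \<open>X\<close> spans. So a chain in \<open>W X (g + k)\<close> can be prolonged by two
  steps for each passage from \<open>m\<close> to \<open>m - 1\<close> as long as \<open>m - 1\<close> still exceeds \<open>g\<close>, and by one last
  step to the whole space. The existence of the generic rank rests on the fact that sums of
  irreducible cones contain an open subset of their closure.\<close>

subsection \<open>Polynomial functions\<close>

text \<open>The constant \<open>2k - 1\<close> is a count. A projective chain of length
  \<open>n\<close> becomes an affine one of length \<open>n + 1\<close> once the apex is put in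
  front; the \<open>k - 1\<close> descents above rank \<open>g + 1\<close> contribute
  \<open>2(k - 1)\<close>, the whole space contributes 1, and the total \<open>n + 2k\<close> cannot
  exceed \<open>N + 1\<close>. The passage from \<open>g + 1\<close> to \<open>g\<close> is worth
  only 1 because the join may then be everything, and an intermediate set is available only below a
  proper join. That chains are bounded at all is a counting argument: functions separating
  consecutive members are algebraically independent.

  The locus of rank exactly \<open>m\<close> may be reducible and neither open nor closed. Density
  in an irreducible set is therefore the only information kept about it; it survives finite covers,
  since one of the parts is again dense. The generic rank asks for more, a value attained on a
  nonempty open set, and there the fibres of a projection have to be controlled by elimination over
  an algebraically closed field.\<close>

inductive_set polyfun :: "(('v \<Rightarrow> 'k::comm_ring_1) \<Rightarrow> 'k) set" where
  const [intro]: "(\<lambda>_. c) \<in> polyfun"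
| coord [intro]: "(\<lambda>v. v i) \<in> polyfun"
| add [intro]: "f \<in> polyfun \<Longrightarrow> g \<in> polyfun \<Longrightarrow> (\<lambda>v. f v + g v) \<in> polyfun"
| mult [intro]: "f \<in> polyfun \<Longrightarrow> g \<in> polyfun \<Longrightarrow> (\<lambda>v. f v * g v) \<in> polyfun"

lemma polyfun_diff [intro]:
  assumes "f \<in> polyfun" "g \<in> polyfun"
  shows "(\<lambda>v. f v - g v) \<in> polyfun"
proof -
  have "(\<lambda>v. f v + (- 1) * g v) \<in> polyfun"
    by (intro polyfun.add polyfun.mult polyfun.const assms)
  then show ?thesis by simp
qed

lemma polyfun_sum [intro]:
  "(\<And>a. a \<in> A \<Longrightarrow> f a \<in> polyfun) \<Longrightarrow> (\<lambda>v. \<Sum>a\<in>A. f a v) \<in> polyfun"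
  by (induction A rule: infinite_finite_induct) (simp_all add: polyfun.intros)

lemma polyfun_prod [intro]:
  "(\<And>a. a \<in> A \<Longrightarrow> f a \<in> polyfun) \<Longrightarrow> (\<lambda>v. \<Prod>a\<in>A. f a v) \<in> polyfun"
  by (induction A rule: infinite_finite_induct) (simp_all add: polyfun.intros)

lemma polyfun_power [intro]: "f \<in> polyfun \<Longrightarrow> (\<lambda>v. f v ^ n) \<in> polyfun"
  by (induction n) (simp_all add: polyfun.intros)

lemma polyfun_comp:
  assumes "f \<in> polyfun" "\<And>i. (\<lambda>v. \<phi> v i) \<in> polyfun"
  shows "(\<lambda>v. f (\<phi> v)) \<in> polyfun"
  using assms(1) by induction (simp_all add: polyfun.intros assms(2))

lemma polyfun_translate: "f \<in> polyfun \<Longrightarrow> (\<lambda>v. f (u + v)) \<in> polyfun"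
  by (erule polyfun_comp) (simp add: polyfun.intros)

lemma polyfun_scale: "f \<in> polyfun \<Longrightarrow> (\<lambda>v. f (\<lambda>i. t * v i)) \<in> polyfun"
  by (erule polyfun_comp) (simp add: polyfun.intros)

text \<open>Questions about cones reduce to univariate polynomials on lines through the origin,
  where having infinitely many roots forces a polynomial to be zero.\<close>

lemma polyfun_along_line:
  fixes f :: "('v \<Rightarrow> 'k::comm_ring_1) \<Rightarrow> 'k"
  assumes "f \<in> polyfun"
  obtains p where "\<And>t. f (u + (\<lambda>i. t * w i)) = poly p t"
proof -
  have "\<exists>p. \<forall>t. f (u + (\<lambda>i. t * w i)) = poly p t"
    using assms
  proof induction
    case (const c)
    show ?case by (intro exI[of _ "[:c:]"]) simp
  next
    case (coord i)
    show ?case by (intro exI[of _ "[:u i, w i:]"]) simp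
  next
    case (add f g)
    then show ?case by (metis poly_add)
  next
    case (mult f g)
    then show ?case by (metis poly_mult)
  qed
  then show thesis using that by blast
qed

section \<open>Expansion in monomials of bounded degree\<close>

definition box :: "nat \<Rightarrow> ('v \<Rightarrow> nat) set" where
  "box d = {m. \<forall>i. m i \<le> d}"

definition monom_fun :: "('v::finite \<Rightarrow> nat) \<Rightarrow> ('v \<Rightarrow> 'k::comm_ring_1) \<Rightarrow> 'k" where
  "monom_fun m v = (\<Prod>i\<in>UNIV. v i ^ m i)"

lemma box_eq_PiE: "box d = UNIV \<rightarrow>\<^sub>E {..d}"
  by (auto simp: box_def PiE_UNIV_domain)

lemma finite_box [simp]: "finite (box d :: ('v::finite \<Rightarrow> nat) set)"
  by (simp add: box_eq_PiE finite_PiE)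

text \<open>Bounding every exponent separately, instead of the total degree, makes the number of
  monomials an exact power, which keeps the later comparison of dimensions elementary.\<close>

lemma card_box: "card (box d :: ('v::finite \<Rightarrow> nat) set) = (d + 1) ^ card (UNIV :: 'v set)"
  by (simp add: box_eq_PiE card_PiE)

lemma monom_fun_add: "monom_fun (m + m') v = monom_fun m v * monom_fun m' v"
  by (simp add: monom_fun_def power_add prod.distrib)

definition bounded_polyfun :: "nat \<Rightarrow> (('v::finite \<Rightarrow> 'k::comm_ring_1) \<Rightarrow> 'k) \<Rightarrow> bool" where
  "bounded_polyfun d f \<longleftrightarrow> (\<exists>c. \<forall>v. f v = (\<Sum>m\<in>box d. c m * monom_fun m v))"

lemma bounded_polyfun_monom:
  assumes "m \<in> box d"
  shows "bounded_polyfun d (\<lambda>v. c * monom_fun m v)"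
  unfolding bounded_polyfun_def
proof (intro exI allI)
  fix v
  show "c * monom_fun m v = (\<Sum>m'\<in>box d. (if m' = m then c else 0) * monom_fun m' v)"
    using assms by (simp add: if_distrib[of "\<lambda>x. x * _"] sum.delta cong: if_cong)
qed

lemma bounded_polyfun_mono:
  assumes "bounded_polyfun d f" "d \<le> e"
  shows "bounded_polyfun e f"
proof -
  obtain c where c: "\<And>v. f v = (\<Sum>m\<in>box d. c m * monom_fun m v)"
    using assms(1) by (auto simp: bounded_polyfun_def)
  have sub: "box d \<subseteq> (box e :: ('a \<Rightarrow> nat) set)"
    using assms(2) by (auto simp: box_def intro: order_trans)
  have "f v = (\<Sum>m\<in>box e. (if m \<in> box d then c m else 0) * monom_fun m v)" for v
    unfolding c using sub by (intro sum.mono_neutral_cong_left) auto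
  then show ?thesis unfolding bounded_polyfun_def by (intro exI allI)
qed

lemma bounded_polyfun_add:
  assumes "bounded_polyfun d f" "bounded_polyfun d g"
  shows "bounded_polyfun d (\<lambda>v. f v + g v)"
proof -
  obtain a b where "\<And>v. f v = (\<Sum>m\<in>box d. a m * monom_fun m v)"
    "\<And>v. g v = (\<Sum>m\<in>box d. b m * monom_fun m v)"
    using assms by (auto simp: bounded_polyfun_def)
  then show ?thesis unfolding bounded_polyfun_def
    by (intro exI[of _ "\<lambda>m. a m + b m"]) (simp add: sum.distrib distrib_right)
qed

lemma bounded_polyfun_sum:
  "(\<And>a. a \<in> A \<Longrightarrow> bounded_polyfun d (f a)) \<Longrightarrow> bounded_polyfun d (\<lambda>v. \<Sum>a\<in>A. f a v)"
proof (induction A rule: infinite_finite_induct)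
  case (insert x F)
  then show ?case by (auto intro: bounded_polyfun_add)
qed (auto simp: bounded_polyfun_def intro!: exI[of _ "\<lambda>_. 0"])

lemma bounded_polyfun_mult:
  assumes "bounded_polyfun d f" "bounded_polyfun e g"
  shows "bounded_polyfun (d + e) (\<lambda>v. f v * g v)"
proof -
  obtain a b where ab: "\<And>v. f v = (\<Sum>m\<in>box d. a m * monom_fun m v)"
    "\<And>v. g v = (\<Sum>m\<in>box e. b m * monom_fun m v)"
    using assms by (auto simp: bounded_polyfun_def)
  have "f v * g v = (\<Sum>m\<in>box d. \<Sum>m'\<in>box e. (a m * b m') * monom_fun (m + m') v)" for v
    unfolding ab sum_product by (simp add: monom_fun_add mult_ac)
  moreover have "bounded_polyfun (d + e)
      (\<lambda>v. \<Sum>m\<in>box d. \<Sum>m'\<in>box e. (a m * b m') * monom_fun (m + m') v)"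
    by (intro bounded_polyfun_sum bounded_polyfun_monom) (auto simp: box_def intro: add_mono)
  ultimately show ?thesis by presburger
qed

lemma bounded_polyfun_const: "bounded_polyfun d (\<lambda>_. c)"
proof -
  have "bounded_polyfun d (\<lambda>v. c * monom_fun (\<lambda>_. 0) v)"
    by (rule bounded_polyfun_monom) (simp add: box_def)
  then show ?thesis by (simp add: monom_fun_def)
qed

lemma bounded_polyfun_power:
  "bounded_polyfun d f \<Longrightarrow> bounded_polyfun (n * d) (\<lambda>v. f v ^ n)"
  by (induction n) (auto intro: bounded_polyfun_const bounded_polyfun_mult)

lemma bounded_polyfun_prod:
  assumes "finite A" "\<And>a. a \<in> A \<Longrightarrow> bounded_polyfun d (f a)"
  shows "bounded_polyfun (card A * d) (\<lambda>v. \<Prod>a\<in>A. f a v)"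
  using assms by (induction A) (auto intro: bounded_polyfun_const bounded_polyfun_mult)

lemma polyfun_bounded:
  assumes "f \<in> polyfun"
  shows "\<exists>d. bounded_polyfun d f"
  using assms
proof induction
  case (const c)
  show ?case using bounded_polyfun_const by blast
next
  case (coord i)
  have "bounded_polyfun 1 (\<lambda>v. 1 * monom_fun (\<lambda>j. if j = i then 1 else 0) v)"
    by (rule bounded_polyfun_monom) (simp add: box_def)
  then show ?case by (auto simp: monom_fun_def if_distrib prod.delta cong: if_cong)
next
  case (add f g)
  then obtain d e where "bounded_polyfun d f" "bounded_polyfun e g" by blast
  then have "bounded_polyfun (max d e) f" "bounded_polyfun (max d e) g"
    by (auto intro: bounded_polyfun_mono)
  then show ?case by (blast intro: bounded_polyfun_add)
next
  case (mult f g)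
  then show ?case by (blast intro: bounded_polyfun_mult)
qed

subsection \<open>Closure and irreducibility\<close>

definition vanishes :: "('a \<Rightarrow> 'k::zero) \<Rightarrow> 'a set \<Rightarrow> bool" where
  "vanishes f S \<longleftrightarrow> (\<forall>v\<in>S. f v = 0)"

lemma vanishesI [intro]: "(\<And>v. v \<in> S \<Longrightarrow> f v = 0) \<Longrightarrow> vanishes f S"
  and vanishesD: "vanishes f S \<Longrightarrow> v \<in> S \<Longrightarrow> f v = 0"
  by (auto simp: vanishes_def)

lemma vanishes_subset: "vanishes f T \<Longrightarrow> S \<subseteq> T \<Longrightarrow> vanishes f S"
  by (auto simp: vanishes_def)

text \<open>Zariski closure in affine space, taken with respect to all polynomial functions:
  translating a homogeneous equation destroys its homogeneity, and translations are used
  throughout.\<close>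

definition acl :: "('v \<Rightarrow> 'k::comm_ring_1) set \<Rightarrow> ('v \<Rightarrow> 'k) set" where
  "acl S = {v. \<forall>f\<in>polyfun. vanishes f S \<longrightarrow> f v = 0}"

lemma aclI: "(\<And>f. f \<in> polyfun \<Longrightarrow> vanishes f S \<Longrightarrow> f v = 0) \<Longrightarrow> v \<in> acl S"
  by (simp add: acl_def)

lemma aclD: "v \<in> acl S \<Longrightarrow> f \<in> polyfun \<Longrightarrow> vanishes f S \<Longrightarrow> f v = 0"
  by (simp add: acl_def)

lemma subset_acl: "S \<subseteq> acl S"
  by (auto simp: acl_def vanishes_def)

lemma vanishes_acl [simp]:
  assumes "f \<in> polyfun"
  shows "vanishes f (acl S) \<longleftrightarrow> vanishes f S"
  using assms subset_acl[of S] aclD[of _ S f] by (meson vanishesI vanishes_subset)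

lemma acl_subset_acl:
  assumes "S \<subseteq> acl T"
  shows "acl S \<subseteq> acl T"
proof
  fix v assume v: "v \<in> acl S"
  show "v \<in> acl T"
  proof (rule aclI)
    fix f assume f: "f \<in> polyfun" "vanishes f T"
    then have "vanishes f S" using assms by (meson vanishes_acl vanishes_subset)
    with v f(1) show "f v = 0" by (rule aclD)
  qed
qed

lemma acl_acl [simp]: "acl (acl S) = acl S"
  by (simp add: acl_subset_acl subset_acl subset_antisym)

lemma acl_mono: "S \<subseteq> T \<Longrightarrow> acl S \<subseteq> acl T"
  by (meson acl_subset_acl order_trans subset_acl)

lemma acl_minimal: "S \<subseteq> T \<Longrightarrow> acl T = T \<Longrightarrow> acl S \<subseteq> T"
  using acl_mono by blast

lemma acl_empty [simp]: "acl {} = {}"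
proof -
  have "(\<lambda>_. 1 :: 'k::comm_ring_1) \<in> polyfun" by blast
  then show ?thesis by (fastforce dest: aclD simp: vanishes_def)
qed

lemma acl_singleton [simp]: "acl {p} = {p}"
proof -
  have "v = p" if "v \<in> acl {p}" for v
  proof
    fix i
    have "(\<lambda>v. v i - p i) \<in> polyfun" by (intro polyfun_diff polyfun.intros)
    then have "v i - p i = 0" by (rule aclD[OF that]) (simp add: vanishes_def)
    then show "v i = p i" by simp
  qed
  then show ?thesis using subset_acl by blast
qed

text \<open>Continuity of polynomial maps: an equation of \<open>T\<close> pulls back along
  \<open>\<phi>\<close> to an equation of \<open>S\<close>.\<close>

lemma acl_map:
  assumes "\<And>i. (\<lambda>v. \<phi> v i) \<in> polyfun" "\<phi> ` S \<subseteq> acl T"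
  shows "\<phi> ` acl S \<subseteq> acl T"
proof
  fix w assume "w \<in> \<phi> ` acl S"
  then obtain v where v: "v \<in> acl S" "w = \<phi> v" by blast
  show "w \<in> acl T"
  proof (rule aclI)
    fix f assume f: "f \<in> polyfun" "vanishes f T"
    then have "vanishes (\<lambda>v. f (\<phi> v)) S"
      using assms(2) by (auto dest: aclD intro!: vanishesI)
    then show "f w = 0"
      using aclD[OF v(1) polyfun_comp[OF f(1) assms(1)]] v(2) by simp
  qed
qed

lemma acl_translate:
  assumes "\<And>v. v \<in> S \<Longrightarrow> v + x \<in> acl T" "v \<in> acl S"
  shows "v + x \<in> acl T"
proof -
  have "(\<lambda>v. v + x) ` acl S \<subseteq> acl T"
    by (rule acl_map) (use assms(1) in \<open>auto simp: polyfun.intros\<close>)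
  then show ?thesis using assms(2) by blast
qed

text \<open>The closure is taken in one summand at a time, so that only the continuity of
  translations is needed: first by a point of \<open>B\<close>, then by a point of
  \<open>acl A\<close>.\<close>

lemma acl_plus: "acl A + acl B \<subseteq> acl (A + B)"
proof -
  have 1: "v + x \<in> acl (A + B)" if "v \<in> acl A" "x \<in> B" for v x
    using acl_translate[OF _ that(1), of x "A + B"] that(2) subset_acl by blast
  have "x + v \<in> acl (A + B)" if "v \<in> acl A" "x \<in> acl B" for v x
    by (rule acl_translate[OF _ that(2), of v])
      (metis 1 that(1) add.commute)
  then show ?thesis by (auto simp: add.commute elim!: set_plus_elim)
qed

text \<open>The vanishing ideal is prime. Closedness is deliberately not part of it, so that dense
  subsets, sums and images can be treated directly.\<close>

definition irred :: "('v \<Rightarrow> 'k::comm_ring_1) set \<Rightarrow> bool" where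
  "irred S \<longleftrightarrow> S \<noteq> {} \<and> (\<forall>f\<in>polyfun. \<forall>g\<in>polyfun.
     vanishes (\<lambda>v. f v * g v) S \<longrightarrow> vanishes f S \<or> vanishes g S)"

lemma irred_multD:
  assumes "irred S" "f \<in> polyfun" "g \<in> polyfun" "vanishes (\<lambda>v. f v * g v) S"
  shows "vanishes f S \<or> vanishes g S"
  using assms by (auto simp: irred_def)

lemma irred_powerD:
  fixes S :: "('v \<Rightarrow> 'k::comm_ring_1) set"
  assumes "irred S" "f \<in> polyfun" "vanishes (\<lambda>v. f v ^ n) S"
  shows "vanishes f S"
  using assms(3)
proof (induction n)
  case 0
  with assms(1) show ?case by (auto simp: irred_def vanishes_def)
next
  case (Suc n)
  then show ?case using irred_multD[OF assms(1,2) polyfun_power[OF assms(2)]] by auto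
qed

lemma irred_acl [simp]: "irred (acl S) \<longleftrightarrow> irred S"
proof -
  have "acl S = {} \<longleftrightarrow> S = {}" using subset_acl[of S] by auto
  then show ?thesis by (simp add: irred_def polyfun.mult)
qed

lemma irred_image:
  assumes "irred S" "\<And>i. (\<lambda>v. \<phi> v i) \<in> polyfun"
  shows "irred (\<phi> ` S)"
  unfolding irred_def
proof (intro conjI ballI impI)
  fix f g assume fg: "f \<in> polyfun" "g \<in> polyfun" "vanishes (\<lambda>v. f v * g v) (\<phi> ` S)"
  then have "vanishes (\<lambda>v. f (\<phi> v) * g (\<phi> v)) S" by (auto simp: vanishes_def)
  then have "vanishes (\<lambda>v. f (\<phi> v)) S \<or> vanishes (\<lambda>v. g (\<phi> v)) S"
    using irred_multD[OF assms(1) polyfun_comp[OF fg(1) assms(2)] polyfun_comp[OF fg(2) assms(2)]]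
    by simp
  then show "vanishes f (\<phi> ` S) \<or> vanishes g (\<phi> ` S)" by (auto simp: vanishes_def)
qed (use assms(1) in \<open>auto simp: irred_def\<close>)

text \<open>Two points of \<open>A + B\<close> witness that neither factor vanishes. Irreducibility
  of \<open>A\<close> replaces their first summands by one common \<open>s\<close>; irreducibility
  of \<open>B\<close> then applies to the translates of \<open>f\<close> and \<open>g\<close> by
  \<open>s\<close>.\<close>

lemma irred_plus:
  assumes A: "irred A" and B: "irred B"
  shows "irred (A + B)"
  unfolding irred_def
proof (intro conjI ballI impI)
  show "A + B \<noteq> {}"
    using A B by (metis equals0I irred_def set_plus_intro empty_iff)
next
  fix f g assume fg: "f \<in> polyfun" "g \<in> polyfun" "vanishes (\<lambda>v. f v * g v) (A + B)"
  show "vanishes f (A + B) \<or> vanishes g (A + B)"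
  proof (rule ccontr)
    assume "\<not> ?thesis"
    then obtain s1 t1 s2 t2 where st: "s1 \<in> A" "t1 \<in> B" "s2 \<in> A" "t2 \<in> B"
      "f (s1 + t1) \<noteq> 0" "g (s2 + t2) \<noteq> 0"
      by (auto simp: vanishes_def elim!: set_plus_elim)
    have "\<not> vanishes (\<lambda>v. f (t1 + v) * g (t2 + v)) A"
    proof
      assume "vanishes (\<lambda>v. f (t1 + v) * g (t2 + v)) A"
      from irred_multD[OF A polyfun_translate[OF fg(1)] polyfun_translate[OF fg(2)] this]
      show False using st by (auto simp: vanishes_def add.commute)
    qed
    then obtain s where s: "s \<in> A" "f (t1 + s) * g (t2 + s) \<noteq> 0" by (auto simp: vanishes_def)
    have "vanishes (\<lambda>v. f (s + v) * g (s + v)) B"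
      using fg(3) s(1) by (auto simp: vanishes_def)
    from irred_multD[OF B polyfun_translate[OF fg(1)] polyfun_translate[OF fg(2)] this]
    show False
    proof
      assume "vanishes (\<lambda>v. f (s + v)) B"
      from vanishesD[OF this st(2)] s(2) show False by (auto simp: add.commute)
    next
      assume "vanishes (\<lambda>v. g (s + v)) B"
      from vanishesD[OF this st(4)] s(2) show False by (auto simp: add.commute)
    qed
  qed
qed

text \<open>Otherwise an equation of each part, not valid on \<open>S\<close>, could be chosen, and
  their product would vanish on \<open>S\<close>. The parts \<open>A\<close> and \<open>B\<close>
  are arbitrary sets, which is what makes rank loci manageable.\<close>

lemma irred_dense_in_cover:
  assumes "irred S" "S \<subseteq> A \<union> B"
  shows "S \<subseteq> acl (S \<inter> A) \<or> S \<subseteq> acl (S \<inter> B)"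
proof (rule ccontr)
  assume "\<not> ?thesis"
  then obtain f g where fg: "f \<in> polyfun" "vanishes f (S \<inter> A)" "\<not> vanishes f S"
    "g \<in> polyfun" "vanishes g (S \<inter> B)" "\<not> vanishes g S"
    by (auto simp: acl_def vanishes_def)
  have "vanishes (\<lambda>v. f v * g v) S"
  proof
    fix v assume "v \<in> S"
    with assms(2) consider "v \<in> S \<inter> A" | "v \<in> S \<inter> B" by blast
    then show "f v * g v = 0" using vanishesD[OF fg(2)] vanishesD[OF fg(5)] by cases auto
  qed
  then show False using irred_multD[OF assms(1)] fg by blast
qed

lemma irred_dense_open:
  assumes "irred S" "f \<in> polyfun" "\<not> vanishes f S"
  shows "S \<subseteq> acl (S \<inter> {v. f v \<noteq> 0})"
proof -
  have "vanishes f (S \<inter> {v. f v = 0})" by (auto simp: vanishes_def)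
  then have "\<not> S \<subseteq> acl (S \<inter> {v. f v = 0})"
    using assms(2,3) by (meson vanishes_acl vanishes_subset)
  then show ?thesis
    using irred_dense_in_cover[OF assms(1), of "{v. f v = 0}" "{v. f v \<noteq> 0}"] by blast
qed

lemma irred_singleton: "irred {p :: 'v \<Rightarrow> 'k::idom}"
  by (auto simp: irred_def vanishes_def)

section \<open>Lines through the origin\<close>

definition line :: "('v \<Rightarrow> 'k::comm_ring_1) \<Rightarrow> ('v \<Rightarrow> 'k) set" where
  "line x = range (\<lambda>t i. t * x i)"

text \<open>Multiplying by the variable supplies the missing root at zero.\<close>

lemma poly_zero_off_zero:
  fixes p :: "'k::field_char_0 poly"
  assumes "\<And>t. t \<noteq> 0 \<Longrightarrow> poly p t = 0"
  shows "p = 0"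
proof -
  have "pCons 0 p = 0"
    by (rule poly_all_0_iff_0[THEN iffD1]) (use assms in auto)
  then show ?thesis by simp
qed

lemma irred_line: "irred (line (x :: 'v \<Rightarrow> 'k::field_char_0))"
  unfolding irred_def
proof (intro conjI ballI impI)
  fix f g :: "('v \<Rightarrow> 'k) \<Rightarrow> 'k" assume fg: "f \<in> polyfun" "g \<in> polyfun" "vanishes (\<lambda>v. f v * g v) (line x)"
  obtain p where p: "\<And>t. f (0 + (\<lambda>i. t * x i)) = poly p t"
    using polyfun_along_line[OF fg(1), of 0 x] by blast
  obtain q where q: "\<And>t. g (0 + (\<lambda>i. t * x i)) = poly q t"
    using polyfun_along_line[OF fg(2), of 0 x] by blast
  have "poly (p * q) t = 0" for t
  proof -
    have "f (\<lambda>i. t * x i) * g (\<lambda>i. t * x i) = 0"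
      by (rule vanishesD[OF fg(3)]) (simp add: line_def)
    then show ?thesis using p[of t] q[of t] by (metis add_0 poly_mult)
  qed
  then have "p * q = 0" using poly_all_0_iff_0[of "p * q"] by blast
  then have "p = 0 \<or> q = 0" by simp
  moreover have "vanishes f (line x)" if "p = 0"
    using p that by (simp add: vanishes_def line_def)
  moreover have "vanishes g (line x)" if "q = 0"
    using q that by (simp add: vanishes_def line_def)
  ultimately show "vanishes f (line x) \<or> vanishes g (line x)" by blast
qed (auto simp: line_def)

lemma zero_in_line [simp]: "0 \<in> line x"
  and base_in_line [simp]: "x \<in> line x"
  by (auto simp: line_def zero_fun_def intro: image_eqI[where x = 0] image_eqI[where x = 1])

lemma line_plus: "v \<in> line x \<Longrightarrow> w \<in> line x \<Longrightarrow> v + w \<in> line x"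
  by (auto simp: line_def plus_fun_def distrib_right[symmetric])

subsection \<open>Chains of irreducible closed sets\<close>

text \<open>Gaussian elimination: if equation \<open>l\<close> involves the unknown
  \<open>i0\<close>, it is solved for that unknown, whose value \<open>- r\<close> is substituted
  into the remaining equations.\<close>

lemma underdetermined_system:
  fixes A :: "'i \<Rightarrow> 'l \<Rightarrow> 'k::field"
  assumes "finite L" "finite I" "card L < card I"
  shows "\<exists>c. (\<exists>i\<in>I. c i \<noteq> 0) \<and> (\<forall>l\<in>L. (\<Sum>i\<in>I. c i * A i l) = 0)"
  using assms
proof (induction L arbitrary: I A rule: finite_induct)
  case empty
  then have "I \<noteq> {}" by auto
  then show ?case by (intro exI[of _ "\<lambda>_. 1"]) auto
next
  case (insert l L)
  show ?case
  proof (cases "\<exists>i0\<in>I. A i0 l \<noteq> 0")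
    case False
    moreover have "card L < card I" using insert by simp
    ultimately obtain c where "\<exists>i\<in>I. c i \<noteq> 0" "\<forall>l\<in>L. (\<Sum>i\<in>I. c i * A i l) = 0"
      using insert.IH[OF insert.prems(1)] by blast
    with False show ?thesis by (intro exI[of _ c]) auto
  next
    case True
    then obtain i0 where i0: "i0 \<in> I" "A i0 l \<noteq> 0" by blast
    define J where "J = I - {i0}"
    have J: "finite J" "i0 \<notin> J" "I = insert i0 J" "card L < card J"
      using insert i0 by (auto simp: J_def)
    obtain c where c: "\<exists>i\<in>J. c i \<noteq> 0"
      "\<forall>l'\<in>L. (\<Sum>i\<in>J. c i * (A i l' - A i l / A i0 l * A i0 l')) = 0"
      using insert.IH[OF J(1,4), of "\<lambda>i l'. A i l' - A i l / A i0 l * A i0 l'"] by blast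
    define r where "r = (\<Sum>i\<in>J. c i * A i l) / A i0 l"
    define c' where "c' = c(i0 := - r)"
    have sum': "(\<Sum>i\<in>I. c' i * A i l') = (\<Sum>i\<in>J. c i * A i l') - r * A i0 l'" for l'
    proof -
      have "(\<Sum>i\<in>J. c' i * A i l') = (\<Sum>i\<in>J. c i * A i l')"
        using J(2) by (intro sum.cong) (auto simp: c'_def)
      then show ?thesis using J(1,2) by (simp add: J(3) c'_def)
    qed
    have "(\<Sum>i\<in>I. c' i * A i l') = 0" if "l' \<in> insert l L" for l'
    proof (cases "l' = l")
      case True
      then show ?thesis unfolding sum' r_def using i0(2) by simp
    next
      case False
      then have "0 = (\<Sum>i\<in>J. c i * A i l' - c i * A i l / A i0 l * A i0 l')"
        using c(2) that by (simp add: right_diff_distrib mult.assoc)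
      also have "\<dots> = (\<Sum>i\<in>J. c i * A i l') - r * A i0 l'"
        by (simp add: sum_subtractf r_def sum_divide_distrib sum_distrib_right)
      finally show ?thesis using sum' by simp
    qed
    moreover have "\<exists>i\<in>I. c' i \<noteq> 0"
      using c(1) J(2,3) by (auto simp: c'_def)
    ultimately show ?thesis by blast
  qed
qed

text \<open>Divide a relation by the lowest power of the last \<open>f i\<close> occurring in it and restrict
  it to the next smaller member of the chain, where that \<open>f i\<close> vanishes.\<close>

lemma chain_algebraic_independence:
  fixes f :: "nat \<Rightarrow> ('v \<Rightarrow> 'k::comm_ring_1) \<Rightarrow> 'k"
  assumes "\<And>i. i \<le> n \<Longrightarrow> irred (C i)" "\<And>i. i < n \<Longrightarrow> C i \<subseteq> C (Suc i)"
    and "\<And>i. i < n \<Longrightarrow> f i \<in> polyfun"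
    and "\<And>i. i < n \<Longrightarrow> vanishes (f i) (C i)"
    and "\<And>i. i < n \<Longrightarrow> \<not> vanishes (f i) (C (Suc i))"
    and "finite I" "\<And>a b i. a \<in> I \<Longrightarrow> b \<in> I \<Longrightarrow> n \<le> i \<Longrightarrow> a i = b i"
    and "vanishes (\<lambda>v. \<Sum>a\<in>I. c a * (\<Prod>i<n. f i v ^ a i)) (C n)"
  shows "\<forall>a\<in>I. c a = 0"
  using assms
proof (induction n arbitrary: I)
  case 0
  obtain v where v: "v \<in> C 0" using 0(1)[of 0] by (auto simp: irred_def)
  \<comment> \<open>All indices are at least 0, so any two exponent vectors in \<open>I\<close>
    coincide and the relation has at most one term.\<close>
  have "a = b" if "a \<in> I" "b \<in> I" for a b
    using 0(7)[OF that] by auto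
  then have "I = {a}" if "a \<in> I" for a using that by blast
  moreover have "(\<Sum>a\<in>I. c a) = 0" using vanishesD[OF 0(8) v] by simp
  ultimately show ?case by fastforce
next
  case (Suc n)
  define J where "J = {a \<in> I. c a \<noteq> 0}"
  have "J = {}"
  proof (rule ccontr)
    assume ne: "J \<noteq> {}"
    have finJ: "finite J" using Suc.prems(6) by (simp add: J_def)
    define b where "b = Min ((\<lambda>a. a n) ` J)"
    have b_le: "b \<le> a n" if "a \<in> J" for a
      using that finJ by (simp add: b_def)
    have "b \<in> (\<lambda>a. a n) ` J"
      unfolding b_def using ne finJ by (intro Min_in) auto
    then obtain a0 where a0: "a0 \<in> J" "a0 n = b" by auto
    define g where "g v = (\<Sum>a\<in>J. c a * (\<Prod>i<n. f i v ^ a i) * f n v ^ (a n - b))" for v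
    have fpoly: "f i \<in> polyfun" if "i \<le> n" for i using Suc.prems(3)[of i] that by simp
    have g_poly: "g \<in> polyfun"
      unfolding g_def
      by (intro polyfun_sum polyfun.mult polyfun.const polyfun_prod polyfun_power fpoly) auto
    have factor: "(\<Sum>a\<in>I. c a * (\<Prod>i<Suc n. f i v ^ a i)) = f n v ^ b * g v" for v
    proof -
      have "(\<Sum>a\<in>I. c a * (\<Prod>i<Suc n. f i v ^ a i)) = (\<Sum>a\<in>J. c a * (\<Prod>i<Suc n. f i v ^ a i))"
        unfolding J_def using Suc.prems(6) by (intro sum.mono_neutral_right) auto
      also have "\<dots> = (\<Sum>a\<in>J. f n v ^ b * (c a * (\<Prod>i<n. f i v ^ a i) * f n v ^ (a n - b)))"
      proof (rule sum.cong[OF refl])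
        fix a assume "a \<in> J"
        then have "f n v ^ a n = f n v ^ b * f n v ^ (a n - b)"
          using b_le by (simp flip: power_add)
        then show "c a * (\<Prod>i<Suc n. f i v ^ a i)
            = f n v ^ b * (c a * (\<Prod>i<n. f i v ^ a i) * f n v ^ (a n - b))"
          by (simp add: mult_ac)
      qed
      finally show ?thesis by (simp add: g_def sum_distrib_left)
    qed
    have "vanishes (\<lambda>v. f n v ^ b * g v) (C (Suc n))"
      using Suc.prems(8) unfolding factor .
    then have "vanishes (\<lambda>v. f n v ^ b) (C (Suc n)) \<or> vanishes g (C (Suc n))"
      using irred_multD[OF Suc.prems(1) polyfun_power[OF fpoly] g_poly] by simp
    moreover have "\<not> vanishes (\<lambda>v. f n v ^ b) (C (Suc n))"
      using irred_powerD[OF Suc.prems(1) fpoly, of "Suc n" n b] Suc.prems(5)[of n] by auto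
    ultimately have "vanishes g (C n)"
      using Suc.prems(2)[of n] vanishes_subset by blast
    define J' where "J' = {a \<in> J. a n = b}"
    have "g v = (\<Sum>a\<in>J'. c a * (\<Prod>i<n. f i v ^ a i))" if "v \<in> C n" for v
    proof -
      have "f n v = 0" using vanishesD[OF Suc.prems(4)[of n] that] by simp
      then have "g v = (\<Sum>a\<in>J'. c a * (\<Prod>i<n. f i v ^ a i) * f n v ^ (a n - b))"
        unfolding g_def
      proof (intro sum.mono_neutral_right ballI)
        fix a assume "a \<in> J - J'"
        then have "a n \<noteq> b" "b \<le> a n" using b_le by (simp_all add: J'_def)
        then have "b < a n" by simp
        with \<open>f n v = 0\<close> have "f n v ^ (a n - b) = 0" by (simp add: power_0_left)
        then show "c a * (\<Prod>i<n. f i v ^ a i) * f n v ^ (a n - b) = 0" by simp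
      qed (simp_all add: J'_def finJ)
      also have "\<dots> = (\<Sum>a\<in>J'. c a * (\<Prod>i<n. f i v ^ a i))"
        by (intro sum.cong) (auto simp: J'_def)
      finally show ?thesis .
    qed
    with \<open>vanishes g (C n)\<close>
    have rel: "vanishes (\<lambda>v. \<Sum>a\<in>J'. c a * (\<Prod>i<n. f i v ^ a i)) (C n)"
      by (simp add: vanishes_def)
    have "\<forall>a\<in>J'. c a = 0"
    proof (rule Suc.IH[of J'])
      show "irred (C i)" if "i \<le> n" for i by (rule Suc.prems(1)) (use that in simp)
      show "C i \<subseteq> C (Suc i)" if "i < n" for i by (rule Suc.prems(2)) (use that in simp)
      show "f i \<in> polyfun" if "i < n" for i by (rule Suc.prems(3)) (use that in simp)
      show "vanishes (f i) (C i)" if "i < n" for i by (rule Suc.prems(4)) (use that in simp)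
      show "\<not> vanishes (f i) (C (Suc i))" if "i < n" for i
        by (rule Suc.prems(5)) (use that in simp)
      show "finite J'" using finJ by (simp add: J'_def)
      show "a i = a' i" if "a \<in> J'" "a' \<in> J'" "n \<le> i" for a a' i
      proof (cases "i = n")
        case True
        with that show ?thesis by (simp add: J'_def)
      next
        case False
        with that show ?thesis using Suc.prems(7)[of a a' i] by (simp add: J'_def J_def)
      qed
    qed (rule rel)
    moreover have "a0 \<in> J'" "c a0 \<noteq> 0" using a0 unfolding J'_def J_def by blast+
    ultimately show False by blast
  qed
  then show ?case by (auto simp: J_def)
qed

section \<open>Affine dimension as a bound on the length of chains\<close>

definition closed_chain :: "nat \<Rightarrow> (nat \<Rightarrow> ('v \<Rightarrow> 'k::comm_ring_1) set) \<Rightarrow> bool" where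
  "closed_chain n C \<longleftrightarrow> (\<forall>i\<le>n. irred (C i) \<and> acl (C i) = C i) \<and> (\<forall>i<n. C i \<subset> C (Suc i))"

text \<open>A chain that is too long yields \<open>K + 1\<close> algebraically independent functions
  in \<open>K\<close> variables. Their power products with exponents below \<open>D\<close> number
  \<open>D ^ (K + 1)\<close>, but they lie in a space of dimension of order \<open>D ^ K\<close>, so
  for large \<open>D\<close> a nontrivial relation exists.\<close>

lemma closed_chain_length:
  fixes C :: "nat \<Rightarrow> ('v::finite \<Rightarrow> 'k::field) set"
  assumes "closed_chain n C"
  shows "n \<le> card (UNIV :: 'v set)"
proof (rule ccontr)
  define K where "K = card (UNIV :: 'v set)"
  define M where "M = Suc K"
  assume "\<not> ?thesis"
  then have "M \<le> n" by (simp add: K_def M_def)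
  have "\<exists>f\<in>polyfun. vanishes f (C i) \<and> \<not> vanishes f (C (Suc i))" if "i < M" for i
  proof -
    have "acl (C i) = C i" "C i \<subset> C (Suc i)"
      using assms that \<open>M \<le> n\<close> by (auto simp: closed_chain_def)
    then obtain v where "v \<in> C (Suc i)" "v \<notin> acl (C i)" by auto
    then show ?thesis by (auto simp: acl_def vanishes_def)
  qed
  then obtain f where f: "\<And>i. i < M \<Longrightarrow> f i \<in> polyfun" "\<And>i. i < M \<Longrightarrow> vanishes (f i) (C i)"
    "\<And>i. i < M \<Longrightarrow> \<not> vanishes (f i) (C (Suc i))"
    by metis
  have "\<forall>i. \<exists>d. i < M \<longrightarrow> bounded_polyfun d (f i)" using f(1) polyfun_bounded by blast
  then obtain d where d: "\<And>i. i < M \<Longrightarrow> bounded_polyfun (d i) (f i)" by metis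
  define e where "e = (\<Sum>i<M. d i)"
  have e: "bounded_polyfun e (f i)" if "i < M" for i
    unfolding e_def by (rule bounded_polyfun_mono[OF d[OF that]]) (use that in \<open>auto intro: member_le_sum\<close>)
  \<comment> \<open>At most \<open>D ^ K * (M * e + 1) ^ K\<close> monomials occur in the
    expansions; \<open>D\<close> is one more than the second factor, so that \<open>D ^ M\<close>
    exceeds this product.\<close>
  define D where "D = Suc ((M * e + 1) ^ K)"
  define I where "I = PiE {..<M} (\<lambda>_. {..<D})"
  have finI: "finite I" unfolding I_def by (intro finite_PiE) auto
  have cardI: "card I = D ^ M" by (simp add: I_def card_PiE)
  define B where "B = M * (D * e)"
  have "bounded_polyfun B (\<lambda>v. \<Prod>i<M. f i v ^ a i)" if "a \<in> I" for a
  proof -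
    have "bounded_polyfun (D * e) (\<lambda>v. f i v ^ a i)" if "i < M" for i
    proof (rule bounded_polyfun_mono[OF bounded_polyfun_power[OF e[OF that]]])
      have "a i < D" using \<open>a \<in> I\<close> that by (auto simp: I_def PiE_def)
      then show "a i * e \<le> D * e" by simp
    qed
    then show ?thesis
      using bounded_polyfun_prod[of "{..<M}" "D * e" "\<lambda>i v. f i v ^ a i"] by (simp add: B_def)
  qed
  then obtain A where A: "\<And>a v. a \<in> I \<Longrightarrow> (\<Prod>i<M. f i v ^ a i) = (\<Sum>m\<in>box B. A a m * monom_fun m v)"
    unfolding bounded_polyfun_def by metis
  have "B + 1 \<le> D * (M * e + 1)" by (simp add: B_def D_def algebra_simps)
  then have "(B + 1) ^ K \<le> D ^ K * (M * e + 1) ^ K"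
    by (metis power_mono power_mult_distrib zero_le)
  also have "\<dots> < D ^ K * D" by (simp add: D_def)
  finally have "card (box B :: ('v \<Rightarrow> nat) set) < card I"
    by (simp add: card_box cardI M_def mult.commute flip: K_def)
  from underdetermined_system[OF finite_box finI this, of A]
  obtain c where c: "\<exists>a\<in>I. c a \<noteq> 0" "\<And>m. m \<in> box B \<Longrightarrow> (\<Sum>a\<in>I. c a * A a m) = 0"
    by blast
  have "(\<Sum>a\<in>I. c a * (\<Prod>i<M. f i v ^ a i)) = 0" for v
  proof -
    have "(\<Sum>a\<in>I. c a * (\<Prod>i<M. f i v ^ a i)) = (\<Sum>a\<in>I. \<Sum>m\<in>box B. c a * A a m * monom_fun m v)"
      by (intro sum.cong) (auto simp: A sum_distrib_left mult.assoc)
    also have "\<dots> = (\<Sum>m\<in>box B. (\<Sum>a\<in>I. c a * A a m) * monom_fun m v)"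
      by (subst sum.swap) (simp add: sum_distrib_right)
    finally show ?thesis by (simp add: c(2))
  qed
  then have rel: "vanishes (\<lambda>v. \<Sum>a\<in>I. c a * (\<Prod>i<M. f i v ^ a i)) (C M)" by (simp add: vanishes_def)
  have "\<forall>a\<in>I. c a = 0"
  proof (rule chain_algebraic_independence[where n = M and C = C and f = f])
    show "irred (C i)" if "i \<le> M" for i
      using assms le_trans[OF that \<open>M \<le> n\<close>] unfolding closed_chain_def by blast
    show "C i \<subseteq> C (Suc i)" if "i < M" for i
      using assms less_le_trans[OF that \<open>M \<le> n\<close>] unfolding closed_chain_def by blast
    show "a i = b i" if "a \<in> I" "b \<in> I" "M \<le> i" for a b i
      using that PiE_arb[of a "{..<M}" _ i] PiE_arb[of b "{..<M}" _ i] by (simp add: I_def)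
  qed (fact f finI rel)+
  with c(1) show False by blast
qed

lemma closed_chain_extend:
  assumes "closed_chain n C" "irred Z" "acl Z = Z" "C n \<subset> Z"
  shows "closed_chain (Suc n) (C(Suc n := Z))"
  using assms by (auto simp: closed_chain_def le_Suc_eq less_Suc_eq)

subsection \<open>Elimination of a coordinate\<close>

text \<open>\<open>P\<close> stands for the polynomial function \<open>\<lambda>w. poly (P w) (w i)\<close>.\<close>

definition param_poly :: "'v \<Rightarrow> (('v \<Rightarrow> 'k::comm_ring_1) \<Rightarrow> 'k poly) \<Rightarrow> bool" where
  "param_poly i P \<longleftrightarrow> (\<forall>j. (\<lambda>w. coeff (P w) j) \<in> polyfun) \<and> (\<forall>w t. P (w(i := t)) = P w)"

lemma param_polyD:
  assumes "param_poly i P"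
  shows "(\<lambda>w. coeff (P w) j) \<in> polyfun" "P (w(i := t)) = P w"
  using assms by (auto simp: param_poly_def)

lemma param_poly_add:
  "param_poly i P \<Longrightarrow> param_poly i Q \<Longrightarrow> param_poly i (\<lambda>w. P w + Q w)"
  by (simp add: param_poly_def polyfun.add)

lemma param_poly_diff:
  "param_poly i P \<Longrightarrow> param_poly i Q \<Longrightarrow> param_poly i (\<lambda>w. P w - Q w)"
  by (simp add: param_poly_def polyfun_diff)

lemma param_poly_mult:
  assumes "param_poly i P" "param_poly i Q"
  shows "param_poly i (\<lambda>w. P w * Q w)"
  unfolding param_poly_def coeff_mult
  by (intro conjI allI polyfun_sum polyfun.mult param_polyD[OF assms(1)] param_polyD[OF assms(2)])
    (simp add: param_polyD[OF assms(1)] param_polyD[OF assms(2)])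

lemma param_poly_monom:
  assumes "a \<in> polyfun" "\<And>w t. a (w(i := t)) = a w"
  shows "param_poly i (\<lambda>w. monom (a w) n)"
proof -
  have "(\<lambda>w. if n = j then a w else 0) \<in> polyfun" for j
    using assms(1) by (cases "n = j") (simp_all add: polyfun.const)
  then show ?thesis by (simp add: param_poly_def assms(2))
qed

lemma param_poly_const: "param_poly i (\<lambda>w. [:c:])"
  using param_poly_monom[of "\<lambda>_. c" i 0] by (simp add: polyfun.const monom_0)

lemma param_poly_power: "param_poly i P \<Longrightarrow> param_poly i (\<lambda>w. P w ^ n)"
  by (induction n) (simp_all add: param_poly_mult param_poly_const[of i 1, unfolded pCons_one])

lemma param_poly_coeff_monom:
  "param_poly i P \<Longrightarrow> param_poly i (\<lambda>w. monom (coeff (P w) d) n)"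
  by (rule param_poly_monom) (simp_all add: param_polyD)

text \<open>The degree bound is uniform in \<open>w\<close>, because pseudo-division is carried out
  for all \<open>w\<close> at once and recurses on this bound.\<close>

lemma param_poly_expand:
  fixes f :: "('v \<Rightarrow> 'k::comm_ring_1) \<Rightarrow> 'k"
  assumes "f \<in> polyfun"
  shows "\<exists>P e. param_poly i P \<and> (\<forall>w. degree (P w) \<le> e) \<and> (\<forall>w. f w = poly (P w) (w i))"
  using assms
proof induction
  case (const c)
  show ?case by (intro exI[of _ "\<lambda>_. [:c:]"] exI[of _ 0]) (simp add: param_poly_const)
next
  case (coord l)
  show ?case
  proof (cases "l = i")
    case True
    have "param_poly i (\<lambda>w. monom 1 1)" by (rule param_poly_monom) (auto simp: polyfun.const)
    with True show ?thesis
      by (intro exI[of _ "\<lambda>_. monom 1 1"] exI[of _ 1]) (simp add: degree_monom_le poly_monom)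
  next
    case False
    then have "param_poly i (\<lambda>w. monom (w l) 0)"
      by (intro param_poly_monom) (simp_all add: polyfun.coord)
    then show ?thesis
      by (intro exI[of _ "\<lambda>w. monom (w l) 0"] exI[of _ 0]) (simp add: monom_0)
  qed
next
  case (add f g)
  then obtain P Q d e where PQ: "param_poly i P" "param_poly i Q"
    "\<And>w. degree (P w) \<le> d" "\<And>w. degree (Q w) \<le> e"
    "\<And>w. f w = poly (P w) (w i)" "\<And>w. g w = poly (Q w) (w i)" by blast
  then have "degree (P w + Q w) \<le> max d e" for w
    by (intro degree_add_le) (auto intro: max.coboundedI1 max.coboundedI2)
  with PQ show ?case
    by (intro exI[of _ "\<lambda>w. P w + Q w"] exI[of _ "max d e"]) (simp add: param_poly_add)
next
  case (mult f g)
  then obtain P Q d e where PQ: "param_poly i P" "param_poly i Q"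
    "\<And>w. degree (P w) \<le> d" "\<And>w. degree (Q w) \<le> e"
    "\<And>w. f w = poly (P w) (w i)" "\<And>w. g w = poly (Q w) (w i)" by blast
  then have "degree (P w * Q w) \<le> d + e" for w
    by (meson add_mono degree_mult_le order_trans)
  with PQ show ?case
    by (intro exI[of _ "\<lambda>w. P w * Q w"] exI[of _ "d + e"]) (simp add: param_poly_mult)
qed

text \<open>A strict bound, since \<open>degree\<close> does not tell zero from the nonzero
  constants: the value 0 here means that the whole family is zero, as required for a remainder
  modulo a constant.\<close>

definition deg_below :: "nat \<Rightarrow> ('a \<Rightarrow> 'k::zero poly) \<Rightarrow> bool" where
  "deg_below e P \<longleftrightarrow> (\<forall>w. \<forall>j\<ge>e. coeff (P w) j = 0)"

lemma deg_belowI_degree: "(\<And>w. degree (P w) \<le> e) \<Longrightarrow> deg_below (Suc e) P"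
  unfolding deg_below_def by (meson Suc_le_eq coeff_eq_0 le_less_trans)

text \<open>The leading coefficient of \<open>F\<close> is a function of \<open>w\<close> that may
  have zeros, so the dividend is multiplied by it instead of being divided. The exponent
  \<open>N\<close> and the family \<open>R\<close> are the same for all \<open>w\<close>; the
  quotient is only claimed pointwise.\<close>

lemma pseudo_division:
  fixes F G :: "('v \<Rightarrow> 'k::field) \<Rightarrow> 'k poly"
  assumes F: "param_poly i F" "deg_below (Suc d) F"
    and "param_poly i G" "deg_below e G"
  shows "\<exists>N R. param_poly i R \<and> deg_below d R \<and>
    (\<forall>w. \<exists>q. smult (coeff (F w) d ^ N) (G w) = q * F w + R w)"
  using assms(3,4)
proof (induction e arbitrary: G)
  case 0
  then show ?case
    by (intro exI[of _ 0] exI[of _ G]) (auto simp: deg_below_def intro!: exI[of _ 0])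
next
  case (Suc e)
  show ?case
  proof (cases "e < d")
    case True
    with Suc.prems show ?thesis
      by (intro exI[of _ 0] exI[of _ G]) (auto simp: deg_below_def intro!: exI[of _ 0])
  next
    case False
    define a where "a w = coeff (F w) d" for w
    define m where "m w = monom (coeff (G w) e) (e - d)" for w
    define G' where "G' w = monom (a w) 0 * G w - m w * F w" for w
    have G': "param_poly i G'"
      unfolding G'_def a_def m_def
      by (intro param_poly_diff param_poly_mult param_poly_coeff_monom F(1) Suc.prems(1))
    have "deg_below e G'"
      unfolding deg_below_def
    proof (intro allI impI)
      fix w j assume "e \<le> j"
      show "coeff (G' w) j = 0"
      proof (cases "j = e")
        case True
        with False show ?thesis by (simp add: G'_def m_def a_def coeff_monom_mult
              mult.commute[of "coeff (F w) d"])
      next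
        case False
        with \<open>e \<le> j\<close> \<open>\<not> e < d\<close> Suc.prems(2) F(2) show ?thesis
          by (simp add: G'_def m_def a_def coeff_monom_mult deg_below_def)
      qed
    qed
    then obtain N R where R: "param_poly i R" "deg_below d R"
      "\<forall>w. \<exists>q. smult (a w ^ N) (G' w) = q * F w + R w"
      using Suc.IH[OF G'] unfolding a_def by blast
    have "\<exists>q. smult (a w ^ Suc N) (G w) = q * F w + R w" for w
    proof -
      obtain q where "smult (a w ^ N) (G' w) = q * F w + R w" using R(3) by blast
      then have "smult (a w ^ Suc N) (G w) = (q + smult (a w ^ N) (m w)) * F w + R w"
        by (simp add: G'_def monom_0 smult_diff_right algebra_simps)
      then show ?thesis by blast
    qed
    with R(1,2) show ?thesis unfolding a_def by blast
  qed
qed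

text \<open>Every root \<open>t\<close> of \<open>F\<close> splits off a linear factor that also
  divides \<open>H\<close>, so one factor \<open>H\<close> is spent on each of the
  \<open>degree F\<close> roots, counted with multiplicity.\<close>

lemma roots_subset_imp_dvd_power:
  fixes F H :: "'k::alg_closed_field poly"
  assumes "F \<noteq> 0" "\<And>t. poly F t = 0 \<Longrightarrow> poly H t = 0"
  shows "F dvd H ^ degree F"
  using assms
proof (induction "degree F" arbitrary: F)
  case 0
  then have "is_unit F" by (simp add: is_unit_iff_degree)
  then show ?case by (rule unit_imp_dvd)
next
  case (Suc n)
  then obtain t where t: "poly F t = 0"
    using alg_closed_imp_poly_has_root[of F] by auto
  then obtain F' where F': "F = [:- t, 1:] * F'"
    using poly_eq_0_iff_dvd by blast
  then have "F' \<noteq> 0" using Suc.prems(1) by auto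
  then have "degree F = Suc (degree F')" unfolding F' by (subst degree_mult_eq) auto
  with Suc.hyps(2) have n: "n = degree F'" by simp
  have "F' dvd H ^ degree F'"
    by (rule Suc.hyps(1)[OF n \<open>F' \<noteq> 0\<close>]) (use Suc.prems(2) F' in auto)
  moreover have "[:- t, 1:] dvd H" using Suc.prems(2)[OF t] poly_eq_0_iff_dvd by blast
  ultimately show ?case
    unfolding \<open>degree F = _\<close> by (subst F') (simp only: power_Suc mult_dvd_mono)
qed

text \<open>The points of \<open>S\<close> over a point \<open>w\<close> of the projection are described by a polynomial \<open>F w\<close> of
  minimal degree \<open>d\<close> among those in the vanishing ideal of \<open>S\<close>, as long as its leading coefficient
  does not vanish at \<open>w\<close>. One of its roots is not a root of \<open>H w\<close> unless \<open>F w\<close> divides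
  \<open>(H w) ^ d\<close>, and this is excluded by a nonzero coefficient of the pseudo-remainder.\<close>

lemma eliminate_coordinate:
  fixes S :: "('v \<Rightarrow> 'k::{alg_closed_field, field_char_0}) set"
  assumes S: "irred S" "acl S = S"
    and h: "h \<in> polyfun" "\<not> vanishes h S"
  shows "\<exists>a\<in>polyfun. \<not> vanishes a S \<and>
    (\<forall>w\<in>acl {s(i := t) | s t. s \<in> S}. a w \<noteq> 0 \<longrightarrow> (\<exists>t. w(i := t) \<in> S \<and> h (w(i := t)) \<noteq> 0))"
proof -
  define B where "B = acl {s(i := t) | s t. s \<in> S}"
  define null where "null P \<longleftrightarrow> (\<forall>j. vanishes (\<lambda>w. coeff (P w) j) S)" for P :: "('v \<Rightarrow> 'k) \<Rightarrow> 'k poly"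
  define I where "I = {P. param_poly i P \<and> vanishes (\<lambda>w. poly (P w) (w i)) S}"
  have null_B: "P w = 0" if "param_poly i P" "null P" "w \<in> B" for P w
  proof (rule poly_eqI)
    fix j
    have "vanishes (\<lambda>w. coeff (P w) j) {s(i := t) | s t. s \<in> S}"
      using that(2) by (auto simp: vanishes_def null_def param_polyD(2)[OF that(1)])
    then show "coeff (P w) j = coeff 0 j"
      using aclD[OF _ param_polyD(1)[OF that(1)], of w] that(3) by (simp add: B_def)
  qed
  have mem_S: "w(i := t) \<in> S"
    if "\<And>P e. P \<in> I \<Longrightarrow> deg_below e P \<Longrightarrow> poly (P w) t = 0" for w t
  proof -
    have "w(i := t) \<in> acl S"
    proof (rule aclI)
      fix f assume f: "f \<in> polyfun" "vanishes f S"
      obtain P e where P: "param_poly i P" "\<And>w. degree (P w) \<le> e" "\<And>w. f w = poly (P w) (w i)"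
        using param_poly_expand[OF f(1), of i] by blast
      then have "P \<in> I" using f(2) P(1) by (simp add: I_def vanishes_def P(3))
      from that[OF this deg_belowI_degree[OF P(2)]]
      show "f (w(i := t)) = 0" by (simp add: P(3) param_polyD(2)[OF P(1)])
    qed
    then show ?thesis using S(2) by simp
  qed
  obtain H eH where H: "param_poly i H" "\<And>w. degree (H w) \<le> eH" "\<And>w. h w = poly (H w) (w i)"
    using param_poly_expand[OF h(1), of i] by blast
  have h_upd: "h (w(i := t)) = poly (H w) t" for w t by (simp add: H(3) param_polyD(2)[OF H(1)])
  have not_null: "\<not> null P" if "\<not> vanishes (\<lambda>w. poly (P w) (w i)) S" for P
  proof
    assume "null P"
    then have "P w = 0" if "w \<in> S" for w
      using that by (intro poly_eqI) (simp add: null_def vanishes_def)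
    then have "vanishes (\<lambda>w. poly (P w) (w i)) S" by (simp add: vanishes_def)
    with that show False ..
  qed
  show ?thesis
  proof (cases "\<exists>b F. F \<in> I \<and> deg_below b F \<and> \<not> null F")
    \<comment> \<open>No relation restricts the coordinate \<open>i\<close>: above a point of the
      projection the whole line lies in \<open>S\<close>, and it remains to avoid the roots of a
      nonzero \<open>H w\<close>.\<close>
    case False
    have "\<not> vanishes (\<lambda>w. poly (H w) (w i)) S" using h(2) unfolding H(3) .
    then obtain j where j: "\<not> vanishes (\<lambda>w. coeff (H w) j) S"
      using not_null by (auto simp: null_def)
    show ?thesis
    proof (intro bexI[of _ "\<lambda>w. coeff (H w) j"] conjI j ballI impI)
      fix w assume w: "w \<in> acl {s(i := t) |s t. s \<in> S}" "coeff (H w) j \<noteq> 0"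
      then have "H w \<noteq> 0" by auto
      then obtain t where "poly (H w) t \<noteq> 0" using poly_all_0_iff_0 by blast
      moreover have "w(i := t) \<in> S"
      proof (rule mem_S)
        fix P e assume "P \<in> I" "deg_below e P"
        then have "P w = 0"
          using False null_B[of P w] w(1) by (auto simp: I_def B_def)
        then show "poly (P w) t = 0" by simp
      qed
      ultimately show "\<exists>t. w(i := t) \<in> S \<and> h (w(i := t)) \<noteq> 0" using h_upd by auto
    qed (rule param_polyD(1)[OF H(1)])
  next
    case True
    define b where "b = (LEAST b. \<exists>F. F \<in> I \<and> deg_below b F \<and> \<not> null F)"
    have "\<exists>F. F \<in> I \<and> deg_below b F \<and> \<not> null F"
      unfolding b_def by (rule LeastI_ex) (rule True)
    then obtain F where F: "F \<in> I" "deg_below b F" "\<not> null F" by blast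
    have min: "null P" if "P \<in> I" "deg_below b' P" "b' < b" for P b'
      using that not_less_Least[of b' "\<lambda>b. \<exists>F. F \<in> I \<and> deg_below b F \<and> \<not> null F"]
      unfolding b_def by blast
    have "b \<noteq> 0" using F(2,3) unfolding deg_below_def null_def vanishes_def by (metis le0)
    then obtain d where d: "b = Suc d" using not0_implies_Suc by blast
    define a where "a w = coeff (F w) d" for w
    have ppF: "param_poly i F" using F(1) by (simp add: I_def)
    have a_poly: "a \<in> polyfun" unfolding a_def by (rule param_polyD(1)[OF ppF])
    have a_nonzero: "\<not> vanishes a S"
    proof
      assume a0: "vanishes a S"
      \<comment> \<open>Dropping a leading term that vanishes on \<open>S\<close> changes nothing
        there but lowers the degree bound, against minimality.\<close>
      define F' where "F' w = F w - monom (a w) d" for w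
      have eq: "F' w = F w" if "w \<in> S" for w using vanishesD[OF a0 that] by (simp add: F'_def)
      have "param_poly i F'"
        unfolding F'_def a_def by (intro param_poly_diff ppF param_poly_coeff_monom)
      with F(1) have "F' \<in> I" by (simp add: I_def vanishes_def eq)
      moreover have "\<not> null F'" using F(3) by (simp add: null_def vanishes_def eq)
      moreover have "deg_below d F'"
        using F(2) by (auto simp: deg_below_def F'_def a_def d le_Suc_eq not_less_eq_eq)
      ultimately show False using min d by blast
    qed
    have "deg_below (Suc (d * eH)) (\<lambda>w. H w ^ d)"
    proof (rule deg_belowI_degree)
      show "degree (H w ^ d) \<le> d * eH" for w
        by (metis H(2) degree_power_le le_trans mult.commute mult_le_mono2)
    qed
    from pseudo_division[OF ppF F(2)[unfolded d] param_poly_power[OF H(1)] this]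
    obtain M R where R: "param_poly i R" "deg_below d R"
      "\<And>w. \<exists>q. smult (a w ^ M) (H w ^ d) = q * F w + R w"
      unfolding a_def by blast
    have R_S: "a w ^ M * h w ^ d = poly (R w) (w i)" if "w \<in> S" for w
    proof -
      obtain q where "smult (a w ^ M) (H w ^ d) = q * F w + R w" using R(3) by blast
      then have "poly (smult (a w ^ M) (H w ^ d)) (w i) = poly (q * F w + R w) (w i)" by simp
      moreover have "poly (F w) (w i) = 0" using F(1) that by (auto simp: I_def vanishes_def)
      ultimately show ?thesis by (simp add: H(3))
    qed
    have "\<not> vanishes (\<lambda>w. a w ^ M * h w ^ d) S"
      using irred_multD[OF S(1) polyfun_power[OF a_poly] polyfun_power[OF h(1)]]
        irred_powerD[OF S(1) a_poly] irred_powerD[OF S(1) h(1)] a_nonzero h(2) by blast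
    then have "\<not> vanishes (\<lambda>w. poly (R w) (w i)) S" by (simp add: vanishes_def R_S)
    then obtain j where j: "\<not> vanishes (\<lambda>w. coeff (R w) j) S"
      using not_null by (auto simp: null_def)
    have r_poly: "(\<lambda>w. coeff (R w) j) \<in> polyfun" by (rule param_polyD(1)[OF R(1)])
    show ?thesis
    proof (intro bexI[of _ "\<lambda>w. a w * coeff (R w) j"] conjI ballI impI)
      show "\<not> vanishes (\<lambda>w. a w * coeff (R w) j) S"
        using irred_multD[OF S(1) a_poly r_poly] a_nonzero j by blast
    next
      fix w assume wB: "w \<in> acl {s(i := t) |s t. s \<in> S}" and w: "a w * coeff (R w) j \<noteq> 0"
      have "coeff (F w) k = 0" if "k > d" for k
        using F(2) d that by (simp add: deg_below_def)
      then have "degree (F w) = d"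
        using w le_degree[of "F w" d] degree_le[of d "F w"] by (simp add: a_def)
      have "F w \<noteq> 0" using w by (auto simp: a_def)
      have "\<not> F w dvd H w ^ d"
      proof
        assume dvd: "F w dvd H w ^ d"
        obtain q where "smult (a w ^ M) (H w ^ d) = q * F w + R w" using R(3) by blast
        then have "R w = smult (a w ^ M) (H w ^ d) - q * F w" by simp
        then have "F w dvd R w" using dvd by (simp add: dvd_smult)
        moreover have "R w \<noteq> 0" using w by auto
        ultimately have "d \<le> degree (R w)"
          using dvd_imp_degree_le \<open>degree (F w) = d\<close> by blast
        then have "coeff (R w) (degree (R w)) = 0" using R(2) by (simp add: deg_below_def)
        with \<open>R w \<noteq> 0\<close> show False by simp
      qed
      then obtain t where t: "poly (F w) t = 0" "poly (H w) t \<noteq> 0"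
        using roots_subset_imp_dvd_power[OF \<open>F w \<noteq> 0\<close>, of "H w"] \<open>degree (F w) = d\<close> by blast
      have "w(i := t) \<in> S"
      proof (rule mem_S)
        fix P e assume P: "P \<in> I" "deg_below e P"
        then have ppP: "param_poly i P" by (simp add: I_def)
        \<comment> \<open>The pseudo-remainder of an element of the ideal is in the ideal again and
          has lower degree, so by minimality it vanishes at \<open>w\<close>. Hence
          \<open>P w\<close> is a multiple of \<open>F w\<close> up to a nonzero scalar and inherits
          the root \<open>t\<close>.\<close>
        obtain N Q where Q: "param_poly i Q" "deg_below d Q"
          "\<And>w. \<exists>q. smult (a w ^ N) (P w) = q * F w + Q w"
          using pseudo_division[OF ppF F(2)[unfolded d] ppP P(2)] unfolding a_def by blast
        have "poly (Q w) (w i) = 0" if "w \<in> S" for w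
        proof -
          obtain q where "smult (a w ^ N) (P w) = q * F w + Q w" using Q(3) by blast
          then have "poly (smult (a w ^ N) (P w)) (w i) = poly (q * F w + Q w) (w i)" by simp
          moreover have "poly (F w) (w i) = 0" "poly (P w) (w i) = 0"
            using F(1) P(1) that by (auto simp: I_def vanishes_def)
          ultimately show ?thesis by simp
        qed
        then have "Q \<in> I" using Q(1) by (simp add: I_def vanishes_def)
        then have "Q w = 0" using min[OF _ Q(2)] null_B[OF Q(1)] wB d by (simp add: B_def)
        moreover obtain q where "smult (a w ^ N) (P w) = q * F w + Q w" using Q(3) by blast
        ultimately have "poly (smult (a w ^ N) (P w)) t = 0" using t(1) by simp
        then show "poly (P w) t = 0" using w by simp
      qed
      then show "\<exists>t. w(i := t) \<in> S \<and> h (w(i := t)) \<noteq> 0" using t(2) h_upd by auto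
    qed (intro polyfun.mult a_poly r_poly)
  qed
qed

text \<open>The projection of \<open>S\<close> that forgets the coordinates in \<open>J\<close>,
  replaced by its full preimage so that successive eliminations stay in the same space.\<close>

definition cylinder :: "'v set \<Rightarrow> ('v \<Rightarrow> 'k) set \<Rightarrow> ('v \<Rightarrow> 'k) set" where
  "cylinder J S = {w. \<exists>s\<in>S. \<forall>i. i \<notin> J \<longrightarrow> w i = s i}"

lemma cylinder_insert: "cylinder (insert i J) S = {s(i := t) | s t. s \<in> cylinder J S}"
proof (intro set_eqI iffI)
  fix w assume "w \<in> cylinder (insert i J) S"
  then obtain s where s: "s \<in> S" "\<And>j. j \<notin> insert i J \<Longrightarrow> w j = s j" by (auto simp: cylinder_def)
  then have "w(i := s i) \<in> cylinder J S" by (auto simp: cylinder_def)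
  moreover have "w = (w(i := s i))(i := w i)" by simp
  ultimately show "w \<in> {s(i := t) | s t. s \<in> cylinder J S}" by blast
qed (fastforce simp: cylinder_def)

text \<open>Freeing a coordinate amounts to adding a coordinate axis, which is an irreducible
  line.\<close>

lemma irred_update:
  fixes S :: "('v \<Rightarrow> 'k::field_char_0) set"
  assumes "irred S"
  shows "irred {s(i := t) | s t. s \<in> S}"
proof -
  define u :: "'v \<Rightarrow> 'k" where "u j = (if j = i then 1 else 0)" for j
  have "{s(i := t) | s t. s \<in> S} = S + line u"
  proof (intro set_eqI iffI)
    fix w assume "w \<in> {s(i := t) | s t. s \<in> S}"
    then obtain s t where st: "s \<in> S" "w = s(i := t)" by blast
    have "w = s + (\<lambda>j. (t - s i) * u j)" by (auto simp: st u_def)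
    then show "w \<in> S + line u" using st(1) by (auto simp: line_def intro!: set_plus_intro)
  next
    fix w assume "w \<in> S + line u"
    then obtain s t where st: "s \<in> S" "w = s + (\<lambda>j. t * u j)"
      by (auto simp: line_def elim!: set_plus_elim)
    have "w = s(i := s i + t)" by (auto simp: st u_def)
    then show "w \<in> {s(i := t) | s t. s \<in> S}" using st(1) by blast
  qed
  then show ?thesis using irred_plus[OF assms irred_line] by simp
qed

lemma irred_cylinder:
  fixes S :: "('v \<Rightarrow> 'k::field_char_0) set"
  assumes "finite J" "irred S"
  shows "irred (cylinder J S)"
  using assms
proof (induction J)
  case empty
  have "cylinder {} S = S" by (auto simp: cylinder_def fun_eq_iff[symmetric])
  with empty show ?case by simp
next
  case (insert i J)
  show ?case unfolding cylinder_insert by (rule irred_update) (rule insert.IH[OF insert.prems])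
qed

text \<open>The open condition \<open>a\<close> obtained for the coordinates in \<open>J\<close>
  plays the role of \<open>h\<close> when the next coordinate is eliminated; this is why the single
  step carries such an \<open>h\<close>.\<close>

lemma eliminate_coordinates:
  fixes S :: "('v \<Rightarrow> 'k::{alg_closed_field, field_char_0}) set"
  assumes "finite J" and S: "irred S" "acl S = S" and h: "h \<in> polyfun" "\<not> vanishes h S"
  shows "\<exists>a\<in>polyfun. \<not> vanishes a (cylinder J S) \<and>
    (\<forall>w\<in>acl (cylinder J S). a w \<noteq> 0 \<longrightarrow> (\<exists>w'\<in>S. (\<forall>i. i \<notin> J \<longrightarrow> w' i = w i) \<and> h w' \<noteq> 0))"
  using assms(1)
proof (induction J)
  case empty
  have "cylinder {} S = S" by (auto simp: cylinder_def fun_eq_iff[symmetric])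
  with S(2) h show ?case by (intro bexI[of _ h]) auto
next
  case (insert i J)
  define T where "T = acl (cylinder J S)"
  obtain a where a: "a \<in> polyfun" "\<not> vanishes a (cylinder J S)"
    "\<And>w. w \<in> T \<Longrightarrow> a w \<noteq> 0 \<Longrightarrow> \<exists>w'\<in>S. (\<forall>i. i \<notin> J \<longrightarrow> w' i = w i) \<and> h w' \<noteq> 0"
    using insert.IH unfolding T_def by blast
  have T: "irred T" "acl T = T" "\<not> vanishes a T"
    using irred_cylinder[OF insert.hyps(1) S(1)] a(1,2) by (simp_all add: T_def)
  obtain b where b: "b \<in> polyfun" and b': "\<not> vanishes b T \<and>
    (\<forall>w\<in>acl {s(i := t) | s t. s \<in> T}. b w \<noteq> 0 \<longrightarrow> (\<exists>t. w(i := t) \<in> T \<and> a (w(i := t)) \<noteq> 0))"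
    by (rule bexE[OF eliminate_coordinate[OF T(1,2) a(1) T(3)]])
  have sub: "cylinder (insert i J) S \<subseteq> {s(i := t) | s t. s \<in> T}"
    unfolding cylinder_insert T_def using subset_acl by blast
  show ?case
  proof (intro bexI[of _ b] conjI ballI impI)
    have "cylinder J S \<subseteq> cylinder (insert i J) S" by (auto simp: cylinder_def)
    then show "\<not> vanishes b (cylinder (insert i J) S)"
      using b' vanishes_acl[OF b] vanishes_subset unfolding T_def by metis
  next
    fix w assume w: "w \<in> acl (cylinder (insert i J) S)" "b w \<noteq> 0"
    from bspec[OF conjunct2[OF b'] subsetD[OF acl_mono[OF sub] w(1)]] w(2)
    obtain t where t: "w(i := t) \<in> T" "a (w(i := t)) \<noteq> 0" by blast
    obtain w' where w': "w' \<in> S" "\<And>j. j \<notin> J \<Longrightarrow> w' j = (w(i := t)) j" "h w' \<noteq> 0"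
      using a(3)[OF t] by blast
    then have "w' j = w j" if "j \<notin> insert i J" for j using that by auto
    with w' show "\<exists>w'\<in>S. (\<forall>j. j \<notin> insert i J \<longrightarrow> w' j = w j) \<and> h w' \<noteq> 0" by blast
  qed (rule b)
qed

text \<open>Weaker than its name: \<open>A\<close> only has to contain a nonempty principal open
  subset of its closure. This is the part of Chevalley's theorem on images that is used.\<close>

definition open_in_closure :: "('v \<Rightarrow> 'k::comm_ring_1) set \<Rightarrow> bool" where
  "open_in_closure A \<longleftrightarrow>
     (\<exists>a\<in>polyfun. \<not> vanishes a A \<and> (\<forall>v\<in>acl A. a v \<noteq> 0 \<longrightarrow> v \<in> A))"

text \<open>The sum \<open>A + B\<close> is the projection to the first summand of the closed irreducible set
  \<open>{(v, x). v - x \<in> acl A \<and> x \<in> B}\<close>.\<close>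

lemma open_in_closure_plus:
  fixes A B :: "('v::finite \<Rightarrow> 'k::{alg_closed_field, field_char_0}) set"
  assumes A: "irred A" "open_in_closure A" and B: "irred B" "acl B = B"
  shows "open_in_closure (A + B)"
proof -
  obtain a where a: "a \<in> polyfun" "\<not> vanishes a A" "\<And>v. v \<in> acl A \<Longrightarrow> a v \<noteq> 0 \<Longrightarrow> v \<in> A"
    using A(2) unfolding open_in_closure_def by blast
  \<comment> \<open>The left block of coordinates holds the sum and the right block the second
    summand: \<open>\<phi>1 u + \<phi>2 x\<close> is the pair \<open>(u + x, x)\<close>, and
    \<open>\<psi>1\<close>, \<open>\<psi>2\<close> recover \<open>u\<close> and
    \<open>x\<close>.\<close>
  define \<phi>1 :: "('v \<Rightarrow> 'k) \<Rightarrow> 'v + 'v \<Rightarrow> 'k" where "\<phi>1 u = case_sum u (\<lambda>_. 0)" for u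
  define \<phi>2 :: "('v \<Rightarrow> 'k) \<Rightarrow> 'v + 'v \<Rightarrow> 'k" where "\<phi>2 x = case_sum x x" for x
  define \<psi>1 :: "('v + 'v \<Rightarrow> 'k) \<Rightarrow> 'v \<Rightarrow> 'k" where "\<psi>1 w i = w (Inl i) - w (Inr i)" for w i
  define \<psi>2 :: "('v + 'v \<Rightarrow> 'k) \<Rightarrow> 'v \<Rightarrow> 'k" where "\<psi>2 w i = w (Inr i)" for w i
  have poly_maps: "(\<lambda>u. \<phi>1 u j) \<in> polyfun" "(\<lambda>u. \<phi>2 u j) \<in> polyfun"
    "(\<lambda>u. \<psi>1 u i) \<in> polyfun" "(\<lambda>u. \<psi>2 u i) \<in> polyfun" for i j
    unfolding \<psi>1_def \<psi>2_def \<phi>1_def \<phi>2_def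
    by (cases j, simp_all add: polyfun.const polyfun.coord polyfun_diff)+
  have \<psi>\<phi>: "\<psi>1 (\<phi>1 u + \<phi>2 x) = u" "\<psi>2 (\<phi>1 u + \<phi>2 x) = x" for u x
    by (auto simp: \<phi>1_def \<phi>2_def \<psi>1_def \<psi>2_def)
  have \<phi>\<psi>: "w = \<phi>1 (\<psi>1 w) + \<phi>2 (\<psi>2 w)" for w
  proof
    fix j show "w j = (\<phi>1 (\<psi>1 w) + \<phi>2 (\<psi>2 w)) j"
      by (cases j) (auto simp: \<phi>1_def \<phi>2_def \<psi>1_def \<psi>2_def)
  qed
  define S where "S = \<phi>1 ` acl A + \<phi>2 ` B"
  have "irred S"
    unfolding S_def using A(1) B(1) by (intro irred_plus irred_image poly_maps) auto
  have "\<psi>1 ` acl S \<subseteq> acl A"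
    by (rule acl_map[OF poly_maps(3)]) (auto simp: S_def \<psi>\<phi> elim!: set_plus_elim)
  moreover have "\<psi>2 ` acl S \<subseteq> acl B"
    by (rule acl_map[OF poly_maps(4)]) (auto simp: S_def \<psi>\<phi> B(2) elim!: set_plus_elim)
  ultimately have \<psi>S: "\<psi>1 w \<in> acl A" "\<psi>2 w \<in> B" if "w \<in> acl S" for w
    using that B(2) by auto
  have "acl S \<subseteq> S"
  proof
    fix w assume "w \<in> acl S"
    then have "\<phi>1 (\<psi>1 w) + \<phi>2 (\<psi>2 w) \<in> S"
      unfolding S_def by (intro set_plus_intro imageI \<psi>S(1,2)[unfolded S_def])
    then show "w \<in> S" using \<phi>\<psi> by metis
  qed
  then have "acl S = S" using subset_acl by blast
  \<comment> \<open>Nonvanishing of \<open>h\<close> forces the first summand into \<open>A\<close>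
    itself, and not merely into its closure.\<close>
  define h where "h w = a (\<psi>1 w)" for w
  have "h \<in> polyfun" unfolding h_def by (rule polyfun_comp[OF a(1) poly_maps(3)])
  have "\<not> vanishes h S"
  proof -
    obtain u where u: "u \<in> A" "a u \<noteq> 0" using a(2) by (auto simp: vanishes_def)
    obtain x where x: "x \<in> B" using B(1) by (auto simp: irred_def)
    have "\<phi>1 u + \<phi>2 x \<in> S" unfolding S_def using u(1) x subset_acl by (intro set_plus_intro) auto
    moreover have "h (\<phi>1 u + \<phi>2 x) \<noteq> 0" by (simp add: h_def \<psi>\<phi> u)
    ultimately show ?thesis by (auto simp: vanishes_def)
  qed
  define J :: "('v + 'v) set" where "J = range Inr"
  have "finite J" by (simp add: J_def)
  have Inl_notin: "Inl i \<notin> J" for i by (auto simp: J_def)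
  obtain b where b: "b \<in> polyfun" "\<not> vanishes b (cylinder J S)"
    "\<And>w. w \<in> acl (cylinder J S) \<Longrightarrow> b w \<noteq> 0 \<Longrightarrow> \<exists>w'\<in>S. (\<forall>i. i \<notin> J \<longrightarrow> w' i = w i) \<and> h w' \<noteq> 0"
    using eliminate_coordinates[OF \<open>finite J\<close> \<open>irred S\<close> \<open>acl S = S\<close> \<open>h \<in> polyfun\<close> \<open>\<not> vanishes h S\<close>]
    by blast
  obtain w0 where w0: "w0 \<in> cylinder J S" "b w0 \<noteq> 0" using b(2) by (auto simp: vanishes_def)
  \<comment> \<open>The function \<open>b\<close> may depend on the eliminated block as well.
    Freezing that block at the values of a point where \<open>b\<close> does not vanish turns
    \<open>b\<close> into a function of the sum alone that is not zero on the closure.\<close>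
  define y where "y = w0 \<circ> Inr"
  define \<theta> :: "('v \<Rightarrow> 'k) \<Rightarrow> 'v + 'v \<Rightarrow> 'k" where "\<theta> v = case_sum v y" for v
  have \<theta>_poly: "(\<lambda>v. \<theta> v j) \<in> polyfun" for j
    by (cases j) (simp_all add: \<theta>_def polyfun.const polyfun.coord)
  define c where "c v = b (\<theta> v)" for v
  have c_poly: "c \<in> polyfun" unfolding c_def by (rule polyfun_comp[OF b(1) \<theta>_poly])
  have "\<not> vanishes c (acl (A + B))"
  proof -
    obtain s where s: "s \<in> S" "\<And>i. i \<notin> J \<Longrightarrow> w0 i = s i" using w0(1) by (auto simp: cylinder_def)
    obtain u x where ux: "u \<in> acl A" "x \<in> B" "s = \<phi>1 u + \<phi>2 x"
      using s(1) by (auto simp: S_def elim!: set_plus_elim)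
    have "\<theta> (u + x) = w0"
    proof
      fix j show "\<theta> (u + x) j = w0 j"
        by (cases j) (simp_all add: \<theta>_def y_def s(2)[OF Inl_notin] ux(3) \<phi>1_def \<phi>2_def)
    qed
    then have "c (u + x) \<noteq> 0" using w0(2) by (simp add: c_def)
    moreover have "u + x \<in> acl (A + B)"
      using acl_plus[of A B] ux(1,2) B(2) by (auto intro: subsetD)
    ultimately show ?thesis by (auto simp: vanishes_def)
  qed
  then have "\<not> vanishes c (A + B)" using c_poly by simp
  moreover have "v \<in> A + B" if v: "v \<in> acl (A + B)" "c v \<noteq> 0" for v
  proof -
    have "\<theta> ` acl (A + B) \<subseteq> acl (cylinder J S)"
    proof (rule acl_map[OF \<theta>_poly])
      have "\<theta> (u + x) \<in> cylinder J S" if "u \<in> A" "x \<in> B" for u x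
      proof -
        have "\<phi>1 u + \<phi>2 x \<in> S"
          unfolding S_def using that subset_acl by (intro set_plus_intro) auto
        moreover have "\<theta> (u + x) j = (\<phi>1 u + \<phi>2 x) j" if "j \<notin> J" for j
          using that by (cases j) (auto simp: \<theta>_def J_def \<phi>1_def \<phi>2_def)
        ultimately show ?thesis unfolding cylinder_def by blast
      qed
      then show "\<theta> ` (A + B) \<subseteq> acl (cylinder J S)"
        using subset_acl by (fastforce elim!: set_plus_elim)
    qed
    then obtain w where w: "w \<in> S" "\<And>i. i \<notin> J \<Longrightarrow> w i = \<theta> v i" "h w \<noteq> 0"
      using b(3)[of "\<theta> v"] v by (auto simp: c_def)
    have "\<psi>1 w \<in> A" "\<psi>2 w \<in> B"
      using \<psi>S[of w] w(1,3) a(3) \<open>acl S = S\<close> by (auto simp: h_def)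
    moreover have "v = \<psi>1 w + \<psi>2 w"
    proof
      fix i show "v i = (\<psi>1 w + \<psi>2 w) i"
        using w(2)[OF Inl_notin, of i] by (simp add: \<psi>1_def \<psi>2_def \<theta>_def)
    qed
    ultimately show ?thesis by (auto intro: set_plus_intro)
  qed
  ultimately show ?thesis using c_poly unfolding open_in_closure_def by blast
qed

subsection \<open>Projective closed sets as affine cones\<close>

definition punctured_cone :: "('v \<Rightarrow> 'k::field) set \<Rightarrow> bool" where
  "punctured_cone Z \<longleftrightarrow> (\<forall>v\<in>Z. \<forall>t. t \<noteq> 0 \<longrightarrow> (\<lambda>i. t * v i) \<in> Z)"

lemma punctured_coneD: "punctured_cone Z \<Longrightarrow> v \<in> Z \<Longrightarrow> t \<noteq> 0 \<Longrightarrow> (\<lambda>i. t * v i) \<in> Z"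
  by (simp add: punctured_cone_def)

lemma punctured_cone_acl:
  assumes "punctured_cone Z"
  shows "punctured_cone (acl Z)"
  unfolding punctured_cone_def
proof (intro ballI allI impI)
  fix v and t :: 'b assume v: "v \<in> acl Z" and t: "t \<noteq> 0"
  have "(\<lambda>v i. t * v i) ` acl Z \<subseteq> acl Z"
    by (rule acl_map)
      (use punctured_coneD[OF assms _ t] subset_acl in \<open>auto simp: polyfun.intros\<close>)
  with v show "(\<lambda>i. t * v i) \<in> acl Z" by blast
qed

section \<open>Homogeneous components of polynomial functions\<close>

lemma peval_polyfun: "peval c \<in> polyfun"
  unfolding peval_def
  by (intro polyfun_sum polyfun.mult polyfun.const polyfun_prod polyfun_power polyfun.coord)

lemma monom_fun_scale:
  "monom_fun m (\<lambda>i. t * v i) = t ^ (\<Sum>i\<in>UNIV. m i) * monom_fun m v"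
  by (simp add: monom_fun_def power_mult_distrib prod.distrib power_sum)

lemma peval_scale:
  fixes c :: "('n::finite \<Rightarrow> nat) \<Rightarrow> 'k::field"
  assumes "\<And>m. c m \<noteq> 0 \<Longrightarrow> (\<Sum>i\<in>UNIV. m i) = d"
  shows "peval c (\<lambda>i. t * v i) = t ^ d * peval c v"
proof -
  have "peval c w = (\<Sum>m | c m \<noteq> 0. c m * monom_fun m w)" for w
    by (simp add: peval_def monom_fun_def)
  then show ?thesis
    using assms by (simp add: monom_fun_scale sum_distrib_left mult_ac)
qed

lemma homogeneous_parts:
  fixes f :: "('n::finite \<Rightarrow> 'k::field) \<Rightarrow> 'k"
  assumes "f \<in> polyfun"
  obtains D h where "\<And>d. is_hpoly (h d)"
    "\<And>d t v. peval (h d) (\<lambda>i. t * v i) = t ^ d * peval (h d) v"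
    "\<And>v. f v = (\<Sum>d<D. peval (h d) v)"
proof -
  obtain e where "bounded_polyfun e f" using polyfun_bounded[OF assms] by blast
  then obtain c where c: "\<And>v. f v = (\<Sum>m\<in>box e. c m * monom_fun m v)"
    by (auto simp: bounded_polyfun_def)
  define deg where "deg m = (\<Sum>i\<in>UNIV. m i)" for m :: "'n \<Rightarrow> nat"
  define h where "h d m = (if m \<in> box e \<and> deg m = d then c m else 0)" for d m
  define D where "D = Suc (e * card (UNIV :: 'n set))"
  have supp: "{m. h d m \<noteq> 0} \<subseteq> {m \<in> box e. deg m = d}" for d by (auto simp: h_def)
  then have "finite {m. h d m \<noteq> 0}" for d by (rule finite_subset) simp
  then have 1: "is_hpoly (h d)" for d
    unfolding is_hpoly_def using supp[of d] by (intro conjI exI[of _ d]) (auto simp: deg_def)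
  have 2: "peval (h d) (\<lambda>i. t * v i) = t ^ d * peval (h d) v" for d t v
    by (rule peval_scale) (auto simp: h_def deg_def split: if_splits)
  have 3: "f v = (\<Sum>d<D. peval (h d) v)" for v
  proof -
    have "peval (h d) v = (\<Sum>m | m \<in> box e \<and> deg m = d. c m * monom_fun m v)" for d
    proof -
      have "peval (h d) v = (\<Sum>m | m \<in> box e \<and> deg m = d. h d m * monom_fun m v)"
        unfolding peval_def monom_fun_def[symmetric] using supp
        by (intro sum.mono_neutral_left) auto
      then show ?thesis by (simp add: h_def cong: sum.cong_simp)
    qed
    moreover have "deg ` box e \<subseteq> {..<D}"
    proof
      fix d assume "d \<in> deg ` box e"
      then obtain m where "m \<in> box e" "d = deg m" by blast
      then show "d \<in> {..<D}"
        using sum_bounded_above[of UNIV m e] by (simp add: deg_def D_def box_def less_Suc_eq_le mult.commute)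
    qed
    ultimately show ?thesis
      using sum.group[of "box e" "{..<D}" deg "\<lambda>m. c m * monom_fun m v"] by (simp add: c)
  qed
  show thesis by (rule that[OF 1 2 3])
qed

text \<open>For fixed \<open>v\<close> the function \<open>t\<close> to \<open>f (t v)\<close> is a
  univariate polynomial whose coefficients are the values of the parts at \<open>v\<close>, and it
  is zero for every nonzero \<open>t\<close>.\<close>

lemma vanishes_homogeneous_parts:
  fixes f :: "('n::finite \<Rightarrow> 'k::field_char_0) \<Rightarrow> 'k"
  assumes "punctured_cone Z" "vanishes f Z"
    and h: "\<And>d t v. peval (h d) (\<lambda>i. t * v i) = t ^ d * peval (h d) v"
    and f: "\<And>v. f v = (\<Sum>d<D. peval (h d) v)"
    and "d < D"
  shows "vanishes (peval (h d)) Z"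
proof
  fix v assume v: "v \<in> Z"
  define p where "p = (\<Sum>d<D. monom (peval (h d) v) d)"
  have "poly p t = 0" if "t \<noteq> 0" for t
  proof -
    have "poly p t = f (\<lambda>i. t * v i)"
      by (simp add: p_def poly_sum poly_monom f h mult.commute)
    also have "\<dots> = 0" by (rule vanishesD[OF assms(2) punctured_coneD[OF assms(1) v that]])
    finally show ?thesis .
  qed
  then have "p = 0" by (rule poly_zero_off_zero)
  then have "coeff p d = 0" by simp
  then show "peval (h d) v = 0"
    using \<open>d < D\<close> by (simp add: p_def coeff_sum sum.delta)
qed

text \<open>A polynomial vanishing on a cone does so part by part, so homogeneous equations cut out
  the closure. The hypothesis tolerates \<open>0\<close>, which lies in the affine closure of every
  nonempty cone.\<close>

lemma zclosedI:
  fixes Z :: "('n::finite \<Rightarrow> 'k::field_char_0) set"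
  assumes "0 \<notin> Z" "punctured_cone Z" "acl Z \<subseteq> insert 0 Z"
  shows "zclosed Z"
  unfolding zclosed_def
proof (intro exI conjI)
  let ?F = "{c. is_hpoly c \<and> vanishes (peval c) Z}"
  show "\<forall>c\<in>?F. is_hpoly c" by simp
  have "v \<in> acl Z" if v: "\<And>c. c \<in> ?F \<Longrightarrow> peval c v = 0" for v
  proof (rule aclI)
    fix f :: "('n \<Rightarrow> 'k) \<Rightarrow> 'k" assume f: "f \<in> polyfun" "vanishes f Z"
    obtain D h where h: "\<And>d. is_hpoly (h d)"
      "\<And>d t v. peval (h d) (\<lambda>i. t * v i) = t ^ d * peval (h d) v"
      "\<And>v. f v = (\<Sum>d<D. peval (h d) v)"
      by (rule homogeneous_parts[OF f(1)]) (rule that)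
    have "peval (h d) v = 0" if "d < D" for d
    proof (rule v)
      have "vanishes (peval (h d)) Z"
        by (rule vanishes_homogeneous_parts[OF assms(2) f(2) h(2,3) that])
      with h(1) show "h d \<in> ?F" by simp
    qed
    then show "f v = 0" by (simp add: h(3))
  qed
  then have "v \<in> Z" if "v \<noteq> 0" "\<forall>f\<in>?F. peval f v = 0" for v
    using assms(3) that by blast
  moreover have "v \<noteq> 0 \<and> (\<forall>f\<in>?F. peval f v = 0)" if "v \<in> Z" for v
    using assms(1) that by (auto dest: vanishesD)
  ultimately show "Z = {v. v \<noteq> (\<lambda>_. 0) \<and> (\<forall>f\<in>?F. peval f v = 0)}"
    unfolding zero_fun_def by blast
qed

lemma zclosedD:
  assumes "zclosed Z"
  shows "0 \<notin> Z" "punctured_cone Z" "acl Z \<subseteq> insert 0 Z"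
proof -
  obtain F where F: "\<And>c. c \<in> F \<Longrightarrow> is_hpoly c"
    "Z = {v. v \<noteq> (\<lambda>_. 0) \<and> (\<forall>f\<in>F. peval f v = 0)}"
    using assms by (auto simp: zclosed_def)
  show "0 \<notin> Z" by (simp add: F(2) zero_fun_def)
  show "punctured_cone Z"
    unfolding punctured_cone_def
  proof (intro ballI allI impI)
    fix v t assume v: "v \<in> Z" and t: "t \<noteq> (0 :: 'b)"
    have "peval c (\<lambda>i. t * v i) = 0" if "c \<in> F" for c
    proof -
      from F(1)[OF that] obtain d where "\<And>m. c m \<noteq> 0 \<Longrightarrow> (\<Sum>i\<in>UNIV. m i) = d"
        unfolding is_hpoly_def by blast
      from peval_scale[of c, OF this] show ?thesis using v that by (simp add: F(2))
    qed
    with v t show "(\<lambda>i. t * v i) \<in> Z" by (auto simp: F(2) fun_eq_iff)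
  qed
  show "acl Z \<subseteq> insert 0 Z"
  proof
    fix v assume v: "v \<in> acl Z"
    have "peval c v = 0" if "c \<in> F" for c
      by (rule aclD[OF v peval_polyfun]) (use that in \<open>auto simp: F(2)\<close>)
    then show "v \<in> insert 0 Z" by (auto simp: F(2) zero_fun_def)
  qed
qed

lemma zero_in_acl_cone:
  fixes Z :: "('v \<Rightarrow> 'k::field_char_0) set"
  assumes "punctured_cone Z" "Z \<noteq> {}"
  shows "0 \<in> acl Z"
proof (rule aclI)
  fix f assume f: "f \<in> polyfun" "vanishes f Z"
  obtain v where v: "v \<in> Z" using assms(2) by blast
  obtain p where p: "\<And>t. f (0 + (\<lambda>i. t * v i)) = poly p t"
    using polyfun_along_line[OF f(1), of 0 v] by blast
  have "poly p t = 0" if "t \<noteq> 0" for t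
    using p[of t] vanishesD[OF f(2) punctured_coneD[OF assms(1) v that]] by simp
  then have "p = 0" by (rule poly_zero_off_zero)
  then show "f 0 = 0" using p[of 0] by (simp flip: zero_fun_def)
qed

lemma acl_zclosed:
  fixes Z :: "('n::finite \<Rightarrow> 'k::field_char_0) set"
  assumes "zclosed Z" "Z \<noteq> {}"
  shows "acl Z = insert 0 Z"
  using zclosedD[OF assms(1)] zero_in_acl_cone[of Z] assms(2) subset_acl[of Z] by blast

text \<open>The points whose whole punctured line lies in the zero set of \<open>u\<close> form a
  projectively closed set \<open>V u\<close> even if \<open>u\<close> is not homogeneous. On a line
  through the origin two univariate polynomials have product zero, so one of them is zero, and
  \<open>V f\<close> and \<open>V g\<close> cover \<open>Z\<close>.\<close>

lemma zirreducible_imp_irred: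
  fixes Z :: "('n::finite \<Rightarrow> 'k::field_char_0) set"
  assumes "zirreducible Z"
  shows "irred Z"
  unfolding irred_def
proof (intro conjI ballI impI)
  show "Z \<noteq> {}" using assms by (simp add: zirreducible_def)
next
  fix f g :: "('n \<Rightarrow> 'k) \<Rightarrow> 'k"
  assume fg: "f \<in> polyfun" "g \<in> polyfun" "vanishes (\<lambda>v. f v * g v) Z"
  define V where "V u = {v. v \<noteq> 0 \<and> (\<forall>t. t \<noteq> 0 \<longrightarrow> u (\<lambda>i. t * v i) = 0)}"
    for u :: "('n \<Rightarrow> 'k) \<Rightarrow> 'k"
  have V: "zclosed (V u)" if u: "u \<in> polyfun" for u
  proof (rule zclosedI)
    show "0 \<notin> V u" by (simp add: V_def)
    show "punctured_cone (V u)"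
      unfolding punctured_cone_def
    proof (intro ballI allI impI)
      fix v and t :: 'k assume v: "v \<in> V u" and t: "t \<noteq> 0"
      have "u (\<lambda>i. s * (t * v i)) = 0" if "s \<noteq> 0" for s
      proof -
        have "u (\<lambda>i. (s * t) * v i) = 0" using v t that unfolding V_def by simp
        then show ?thesis by (simp only: mult.assoc)
      qed
      with v t show "(\<lambda>i. t * v i) \<in> V u" by (simp add: V_def fun_eq_iff)
    qed
    show "acl (V u) \<subseteq> insert 0 (V u)"
    proof
      fix v assume v: "v \<in> acl (V u)"
      have "u (\<lambda>i. t * v i) = 0" if "t \<noteq> 0" for t
        by (rule aclD[OF v polyfun_scale[OF u]]) (use that in \<open>auto simp: V_def\<close>)
      then show "v \<in> insert 0 (V u)" by (auto simp: V_def)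
    qed
  qed
  have Z: "zclosed Z" using assms by (simp add: zirreducible_def)
  have "v \<in> V f \<union> V g" if v: "v \<in> Z" for v
  proof -
    obtain p where p: "\<And>t. f (0 + (\<lambda>i. t * v i)) = poly p t"
      using polyfun_along_line[OF fg(1), of 0 v] by blast
    obtain q where q: "\<And>t. g (0 + (\<lambda>i. t * v i)) = poly q t"
      using polyfun_along_line[OF fg(2), of 0 v] by blast
    have "poly (p * q) t = 0" if "t \<noteq> 0" for t
      using p[of t] q[of t] vanishesD[OF fg(3) punctured_coneD[OF zclosedD(2)[OF Z] v that]] by simp
    then have "p * q = 0" by (rule poly_zero_off_zero)
    then have "p = 0 \<or> q = 0" by simp
    moreover have "v \<noteq> 0" using zclosedD(1)[OF Z] v by blast
    moreover have "v \<in> V f" if "p = 0" "v \<noteq> 0" using p that by (simp add: V_def)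
    moreover have "v \<in> V g" if "q = 0" "v \<noteq> 0" using q that by (simp add: V_def)
    ultimately show ?thesis by blast
  qed
  then have "Z \<subseteq> V f \<union> V g" by (rule subsetI)
  with V[OF fg(1)] V[OF fg(2)] have "Z \<subseteq> V f \<or> Z \<subseteq> V g"
    using assms unfolding zirreducible_def by simp
  moreover have "u v = 0" if "v \<in> V u" for u v
    using that[unfolded V_def mem_Collect_eq, THEN conjunct2, THEN spec, of 1] by simp
  ultimately show "vanishes f Z \<or> vanishes g Z" unfolding vanishes_def by blast
qed

text \<open>The affine closure without its apex is projectively closed. An upper bound for the
  projective closure is what a lower bound for the codimension calls for.\<close>

lemma zclosure_subset_acl:
  fixes A :: "('n::finite \<Rightarrow> 'k::field_char_0) set"
  assumes "punctured_cone A" "0 \<notin> A"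
  shows "zclosure A \<subseteq> acl A - {0}"
proof -
  have "zclosed (acl A - {0})"
  proof (rule zclosedI)
    have "punctured_cone (acl A)" by (rule punctured_cone_acl[OF assms(1)])
    then show "punctured_cone (acl A - {0})" by (auto simp: punctured_cone_def fun_eq_iff)
    have "acl (acl A - {0}) \<subseteq> acl A" by (metis Diff_subset acl_subset_acl)
    then show "acl (acl A - {0}) \<subseteq> insert 0 (acl A - {0})" by blast
  qed simp
  moreover have "A \<subseteq> acl A - {0}" using assms(2) subset_acl by blast
  ultimately show ?thesis unfolding zclosure_def by blast
qed

subsection \<open>Secant cones and ranks\<close>

lemma sum_fun_apply: "(\<Sum>a\<in>A. f a) i = (\<Sum>a\<in>A. f a i)"
  by (induction A rule: infinite_finite_induct) simp_all

lemma unit_vector_expansion: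
  fixes v :: "'n::finite \<Rightarrow> 'k::comm_ring_1"
  shows "v = (\<Sum>i\<in>UNIV. (\<lambda>j. v i * (if j = i then 1 else 0)))"
  by (rule ext) (simp add: sum_fun_apply if_distrib[of "\<lambda>x. _ * x"] cong: if_cong)

text \<open>For a cone containing its apex these are the sums of at most \<open>r\<close> points,
  increasing with \<open>r\<close>. Distinctness of the points enters only when ranks are compared
  with \<open>in_span_of\<close>.\<close>

primrec secant :: "('v \<Rightarrow> 'k::comm_ring_1) set \<Rightarrow> nat \<Rightarrow> ('v \<Rightarrow> 'k) set" where
  "secant X 0 = {0}"
| "secant X (Suc r) = secant X r + X"

lemma secant_add: "secant X (r + s) = secant X r + secant X s"
  by (induction s) (simp_all add: add.assoc set_zero[symmetric] del: set_zero)

locale irreducible_cone =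
  fixes X :: "('n::finite \<Rightarrow> 'k::{alg_closed_field, field_char_0}) set"
  assumes irred_X: "irred X" and closed_X: "acl X = X"
    and scale_X: "x \<in> X \<Longrightarrow> (\<lambda>i. t * x i) \<in> X"
    and spanning_X: "a \<noteq> (\<lambda>_. 0) \<Longrightarrow> \<exists>x\<in>X. (\<Sum>i\<in>UNIV. a i * x i) \<noteq> 0"
begin

lemma zero_in_X: "0 \<in> X"
proof -
  obtain x where "x \<in> X" using irred_X by (auto simp: irred_def)
  from scale_X[OF this, of 0] show ?thesis by (simp add: zero_fun_def)
qed

lemma uminus_in_X: "x \<in> X \<Longrightarrow> - x \<in> X"
  using scale_X[of x "- 1"] by (simp add: fun_Compl_def)

lemma secant_Suc_mono: "secant X r \<subseteq> secant X (Suc r)"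
proof
  fix v assume "v \<in> secant X r"
  from set_plus_intro[OF this zero_in_X] show "v \<in> secant X (Suc r)" by simp
qed

lemma secant_mono: "r \<le> s \<Longrightarrow> secant X r \<subseteq> secant X s"
  by (rule lift_Suc_mono_le[of "secant X"]) (rule secant_Suc_mono)

lemma zero_in_secant: "0 \<in> secant X r"
  using secant_mono[of 0 r] by simp

lemma secant_scale: "v \<in> secant X r \<Longrightarrow> (\<lambda>i. t * v i) \<in> secant X r"
proof (induction r arbitrary: v)
  case 0
  then show ?case by (simp add: zero_fun_def)
next
  case (Suc r)
  from Suc.prems obtain u x where ux: "u \<in> secant X r" "x \<in> X" "v = u + x"
    by (auto elim: set_plus_elim)
  have "(\<lambda>i. t * u i) + (\<lambda>i. t * x i) \<in> secant X r + X"
    by (rule set_plus_intro[OF Suc.IH[OF ux(1)] scale_X[OF ux(2)]])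
  moreover have "(\<lambda>i. t * v i) = (\<lambda>i. t * u i) + (\<lambda>i. t * x i)"
    by (simp add: ux(3) fun_eq_iff distrib_left)
  ultimately show ?case by simp
qed

lemma secant_sum:
  assumes "finite A" "\<And>i. i \<in> A \<Longrightarrow> y i \<in> secant X (r i)"
  shows "(\<Sum>i\<in>A. y i) \<in> secant X (\<Sum>i\<in>A. r i)"
  using assms by (induction A) (simp_all add: secant_add set_plus_intro)

lemma secant_one: "secant X 1 = X"
  by (simp add: set_zero[symmetric] del: set_zero)

text \<open>The union of all secant sets is a linear subspace. If it were proper, a nonzero linear
  form would vanish on it and hence on \<open>X\<close>, against \<open>spanning_X\<close>.\<close>

lemma in_some_secant: "\<exists>r. v \<in> secant X r"
proof (rule ccontr)
  interpret vs: vector_space "\<lambda>(t::'k) (v::'n \<Rightarrow> 'k) i. t * v i"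
    by unfold_locales (simp_all add: fun_eq_iff algebra_simps)
  interpret k: vector_space "(*) :: 'k \<Rightarrow> 'k \<Rightarrow> 'k"
    by unfold_locales (simp_all add: algebra_simps)
  interpret vp: vector_space_pair "\<lambda>(t::'k) (v::'n \<Rightarrow> 'k) i. t * v i" "(*) :: 'k \<Rightarrow> 'k \<Rightarrow> 'k" ..
  define L where "L = (\<Union>r. secant X r)"
  assume "\<not> ?thesis"
  then have "v \<notin> L" by (simp add: L_def)
  have L: "vs.subspace L"
  proof (rule vs.subspaceI)
    show "0 \<in> L" using zero_in_secant by (auto simp: L_def)
    show "(\<lambda>i. t * u i) \<in> L" if "u \<in> L" for u t
      using that secant_scale unfolding L_def by fast
    show "u + w \<in> L" if uw: "u \<in> L" "w \<in> L" for u w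
    proof -
      obtain r s where "u \<in> secant X r" "w \<in> secant X s" using uw by (auto simp: L_def)
      then have "u + w \<in> secant X (r + s)" by (simp add: secant_add set_plus_intro)
      then show ?thesis unfolding L_def by blast
    qed
  qed
  obtain B where B: "B \<subseteq> L" "vs.independent B" "L \<subseteq> vs.span B"
    using vs.maximal_independent_subset[of L] by blast
  have "vs.span B \<subseteq> L" using B(1) L by (rule vs.span_minimal)
  with \<open>v \<notin> L\<close> have "v \<notin> vs.span B" by blast
  then have "vs.independent (insert v B)" using B(2) by (rule vs.independent_insertI)
  from vp.linear_independent_extend[OF this, of "\<lambda>x. if x = v then 1 else 0"]
  obtain f where f: "Vector_Spaces.linear (\<lambda>t v i. t * v i) (*) f"
    "\<And>x. x \<in> insert v B \<Longrightarrow> f x = (if x = v then 1 else 0)"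
    by blast
  have "v \<notin> B" using \<open>v \<notin> L\<close> B(1) by blast
  have f_L: "f x = 0" if "x \<in> L" for x
  proof (rule vp.linear_eq_0_on_span[OF f(1)])
    show "x \<in> vs.span B" using that B(3) by blast
    show "f b = 0" if "b \<in> B" for b using f(2)[of b] that \<open>v \<notin> B\<close> by auto
  qed
  define a where "a i = f (\<lambda>j. if j = i then 1 else 0)" for i
  have f_sum: "f x = (\<Sum>i\<in>UNIV. a i * x i)" for x
  proof -
    have "f x = f (\<Sum>i\<in>UNIV. (\<lambda>j. x i * (if j = i then 1 else 0)))"
      by (subst unit_vector_expansion) simp
    also have "\<dots> = (\<Sum>i\<in>UNIV. x i * a i)"
      by (simp add: vp.linear_sum[OF f(1)] vp.linear_scale[OF f(1)] a_def)
    finally show ?thesis by (simp add: mult.commute)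
  qed
  have "f v = 1" using f(2)[of v] by simp
  then have "a \<noteq> (\<lambda>_. 0)" using f_sum[of v] by auto
  then obtain x where x: "x \<in> X" "(\<Sum>i\<in>UNIV. a i * x i) \<noteq> 0" using spanning_X by blast
  have "x \<in> secant X 1" using x(1) secant_one by simp
  then have "x \<in> L" unfolding L_def by blast
  then show False using f_L f_sum x(2) by simp
qed

text \<open>Just some bound for the ranks, not necessarily the largest rank that occurs.\<close>

definition max_rank :: nat where
  "max_rank = (SOME r. secant X r = UNIV)"

lemma secant_max_rank: "secant X max_rank = UNIV"
proof -
  have "\<forall>i. \<exists>r. (\<lambda>j. if j = i then 1 else 0) \<in> secant X r" using in_some_secant by blast
  from choice[OF this] obtain r where r: "\<forall>i. (\<lambda>j. if j = i then 1 else 0) \<in> secant X (r i)" ..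
  have "(\<lambda>j. v i * (if j = i then 1 else 0)) \<in> secant X (r i)" for v i
    using r secant_scale by fast
  then have sum: "(\<Sum>i\<in>UNIV. (\<lambda>j. v i * (if j = i then 1 else 0))) \<in> secant X (\<Sum>i\<in>UNIV. r i)"
    for v by (intro secant_sum) simp_all
  have "v \<in> secant X (\<Sum>i\<in>UNIV. r i)" for v
    by (subst unit_vector_expansion) (rule sum)
  then have "\<exists>r. secant X r = UNIV" by blast
  then show ?thesis unfolding max_rank_def by (rule someI_ex)
qed

section \<open>Rank and generic rank of vectors\<close>

definition rk :: "('n \<Rightarrow> 'k) \<Rightarrow> nat" where
  "rk v = (LEAST r. v \<in> secant X r)"

lemma in_secant_rk: "v \<in> secant X (rk v)"
  unfolding rk_def by (rule LeastI_ex) (rule in_some_secant)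

lemma rk_le_iff: "rk v \<le> r \<longleftrightarrow> v \<in> secant X r"
proof
  show "v \<in> secant X r" if "rk v \<le> r" using in_secant_rk secant_mono[OF that] by blast
  show "rk v \<le> r" if "v \<in> secant X r" unfolding rk_def using that by (rule Least_le)
qed

lemma rk_le_max_rank: "rk v \<le> max_rank"
  by (simp add: rk_le_iff secant_max_rank)

lemma rk_zero: "rk 0 = 0"
  using rk_le_iff[of 0 0] by simp

lemma rk_scale:
  assumes "t \<noteq> 0"
  shows "rk (\<lambda>i. t * v i) = rk v"
proof (rule antisym)
  show "rk (\<lambda>i. t * v i) \<le> rk v" by (simp add: rk_le_iff secant_scale in_secant_rk)
  have "(\<lambda>i. inverse t * (t * v i)) \<in> secant X (rk (\<lambda>i. t * v i))"
    by (rule secant_scale[OF in_secant_rk])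
  then show "rk v \<le> rk (\<lambda>i. t * v i)" using assms by (simp add: rk_le_iff field_simps)
qed

lemma rk_plus_le:
  assumes "x \<in> X"
  shows "rk (v + x) \<le> Suc (rk v)" "rk v \<le> Suc (rk (v + x))"
proof -
  have 1: "rk (v + x) \<le> Suc (rk v)" if "x \<in> X" for v x
    using set_plus_intro[OF in_secant_rk that] by (simp add: rk_le_iff)
  show "rk (v + x) \<le> Suc (rk v)" using assms by (rule 1)
  show "rk v \<le> Suc (rk (v + x))"
    using 1[OF uminus_in_X[OF assms], of "v + x"] by simp
qed

definition generic_rk :: nat where
  "generic_rk = (LEAST r. acl (secant X r) = UNIV)"

lemma acl_secant_generic_rk: "acl (secant X generic_rk) = UNIV"
  unfolding generic_rk_def
proof (rule LeastI)
  show "acl (secant X max_rank) = UNIV" using subset_acl[of UNIV] by (auto simp: secant_max_rank)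
qed

lemma irred_secant: "irred (secant X r)"
  by (induction r) (simp_all add: irred_singleton irred_plus irred_X)

lemma open_in_closure_secant: "open_in_closure (secant X r)"
proof (induction r)
  case 0
  have "\<not> vanishes (\<lambda>_. 1 :: 'k) {0 :: 'n \<Rightarrow> 'k}" by (simp add: vanishes_def)
  then show ?case
    unfolding open_in_closure_def by (intro bexI[of _ "\<lambda>_. 1"]) (simp_all add: polyfun.const)
next
  case (Suc r)
  then show ?case
    using open_in_closure_plus[OF irred_secant _ irred_X closed_X] by simp
qed

lemma irred_UNIV: "irred (UNIV :: ('n \<Rightarrow> 'k) set)"
  using irred_secant[of max_rank] by (simp add: secant_max_rank)

lemma generic_rk_pos: "generic_rk > 0"
proof (rule ccontr)
  assume "\<not> ?thesis"
  then have "{0 :: 'n \<Rightarrow> 'k} = UNIV" using acl_secant_generic_rk by simp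
  then have "(\<lambda>_. 1) = (0 :: 'n \<Rightarrow> 'k)" by (metis UNIV_I singletonD)
  then show False by (simp add: fun_eq_iff)
qed

text \<open>Where \<open>a\<close> is nonzero the rank is at most generic, and where
  \<open>b\<close> is nonzero it is at least generic. The product \<open>a b\<close> need not be
  homogeneous, but it vanishes on the cone of vectors of any other rank, hence so does each of its
  homogeneous parts, and one part is nonzero.\<close>

lemma generic_rk_open:
  obtains c where "is_hpoly c" "\<not> vanishes (peval c) UNIV" "\<And>v. peval c v \<noteq> 0 \<Longrightarrow> rk v = generic_rk"
proof -
  obtain a where a: "a \<in> polyfun" "\<not> vanishes a (secant X generic_rk)"
    "\<And>v. a v \<noteq> 0 \<Longrightarrow> v \<in> secant X generic_rk"
    using open_in_closure_secant[of generic_rk] acl_secant_generic_rk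
    unfolding open_in_closure_def by auto
  obtain s where s: "generic_rk = Suc s" using generic_rk_pos gr0_implies_Suc by blast
  have "acl (secant X s) \<noteq> UNIV"
    using not_less_Least[of s "\<lambda>r. acl (secant X r) = UNIV"] s by (simp add: generic_rk_def)
  then obtain b where b: "b \<in> polyfun" "vanishes b (secant X s)" "\<not> vanishes b UNIV"
    unfolding acl_def vanishes_def by blast
  have ab: "(\<lambda>v. a v * b v) \<in> polyfun" using a(1) b(1) by (rule polyfun.mult)
  have "\<not> vanishes a UNIV" using a(2) vanishes_subset subset_UNIV by blast
  then have "\<not> vanishes (\<lambda>v. a v * b v) UNIV"
    using irred_multD[OF irred_UNIV a(1) b(1)] b(3) by blast
  then obtain w where w: "a w * b w \<noteq> 0" unfolding vanishes_def by blast
  have rk_ab: "rk v = generic_rk" if "a v * b v \<noteq> 0" for v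
  proof (rule antisym)
    show "rk v \<le> generic_rk" using a(3)[of v] that by (simp add: rk_le_iff)
    have "v \<notin> secant X s" using vanishesD[OF b(2), of v] that by auto
    then show "generic_rk \<le> rk v" using rk_le_iff[of v s] s by simp
  qed
  show thesis
  proof (rule homogeneous_parts[OF ab])
    fix D h
    assume h: "\<And>d. is_hpoly (h d)" "\<And>d t v. peval (h d) (\<lambda>i. t * v i) = t ^ d * peval (h d) v"
      "\<And>v. a v * b v = (\<Sum>d<D. peval (h d) v)"
    obtain d where d: "d < D" "peval (h d) w \<noteq> 0"
      using w unfolding h(3) by (meson lessThan_iff sum.neutral)
    have "rk v = generic_rk" if v: "peval (h d) v \<noteq> 0" for v
    proof (rule ccontr)
      assume rk: "rk v \<noteq> generic_rk"
      define Z where "Z = {u. \<exists>t. t \<noteq> 0 \<and> u = (\<lambda>i. t * v i)}"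
      have "punctured_cone Z"
        unfolding punctured_cone_def Z_def
      proof (intro ballI allI impI)
        fix u and t :: 'k assume "u \<in> {u. \<exists>t. t \<noteq> 0 \<and> u = (\<lambda>i. t * v i)}" "t \<noteq> 0"
        then obtain s where "s \<noteq> 0" "u = (\<lambda>i. s * v i)" by blast
        with \<open>t \<noteq> 0\<close> show "(\<lambda>i. t * u i) \<in> {u. \<exists>t. t \<noteq> 0 \<and> u = (\<lambda>i. t * v i)}"
          by (intro CollectI exI[of _ "t * s"]) (simp add: mult.assoc)
      qed
      moreover have "vanishes (\<lambda>v. a v * b v) Z"
      proof
        fix u assume "u \<in> Z"
        then have "rk u \<noteq> generic_rk" using rk rk_scale unfolding Z_def by auto
        then show "a u * b u = 0" using rk_ab by blast
      qed
      ultimately have "vanishes (peval (h d)) Z"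
        by (rule vanishes_homogeneous_parts[OF _ _ h(2,3) d(1)])
      moreover have "v \<in> Z" unfolding Z_def by (intro CollectI exI[of _ 1]) simp
      ultimately show False using v vanishesD by metis
    qed
    moreover have "\<not> vanishes (peval (h d)) UNIV" using d(2) by (auto simp: vanishes_def)
    ultimately show thesis using that h(1) by metis
  qed
qed

definition rk_locus :: "nat \<Rightarrow> ('n \<Rightarrow> 'k) set" where
  "rk_locus m = {v. rk v = m}"

lemma acl_rk_locus_proper:
  assumes "m \<noteq> generic_rk"
  shows "acl (rk_locus m) \<noteq> UNIV"
proof (rule generic_rk_open)
  fix c :: "('n \<Rightarrow> nat) \<Rightarrow> 'k"
  assume c: "\<not> vanishes (peval c) UNIV" "\<And>v. peval c v \<noteq> 0 \<Longrightarrow> rk v = generic_rk"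
  have "vanishes (peval c) (rk_locus m)"
    using c(2) assms unfolding rk_locus_def vanishes_def by blast
  then have "vanishes (peval c) (acl (rk_locus m))" by (simp add: peval_polyfun)
  with c(1) show ?thesis by metis
qed

text \<open>Stability under \<open>X\<close> propagates to all its secant sets, one of which is the
  whole space. Every strict inclusion between a set and its join with \<open>X\<close> comes from
  here.\<close>

lemma closed_under_X_imp_UNIV:
  assumes "V \<noteq> {}" "V + X \<subseteq> V"
  shows "V = UNIV"
proof -
  obtain v where v: "v \<in> V" using assms(1) by blast
  have V_sec: "V + secant X r \<subseteq> V" for r
  proof (induction r)
    case 0
    then show ?case by (auto elim!: set_plus_elim)
  next
    case (Suc r)
    have "V + secant X (Suc r) = (V + secant X r) + X" by (simp add: add.assoc)
    also have "\<dots> \<subseteq> V + X" using Suc.IH by (rule set_plus_mono2) simp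
    finally show ?case using assms(2) by blast
  qed
  have "w \<in> V" for w
  proof -
    have "v + (w - v) \<in> V + secant X max_rank"
      using v by (rule set_plus_intro) (simp add: secant_max_rank)
    then show ?thesis using V_sec by auto
  qed
  then show ?thesis by blast
qed

subsection \<open>Joining the rank loci with the variety\<close>

definition dense_locus :: "nat \<Rightarrow> ('n \<Rightarrow> 'k) set \<Rightarrow> bool" where
  "dense_locus m V \<longleftrightarrow> irred V \<and> acl V = V \<and> V \<subseteq> acl (V \<inter> rk_locus m)"

text \<open>If every such set above \<open>V\<close> could be enlarged, closed chains of arbitrary
  length would arise, against \<open>closed_chain_length\<close>.\<close>

lemma dense_locus_maximal:
  assumes "dense_locus m V"
  obtains V' where "dense_locus m V'" "V \<subseteq> V'"
    "\<And>V''. dense_locus m V'' \<Longrightarrow> V' \<subseteq> V'' \<Longrightarrow> V'' = V'"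
proof (rule ccontr)
  note maximal = that
  assume none: "\<not> thesis"
  have larger: "\<exists>V''. dense_locus m V'' \<and> V' \<subset> V''" if "dense_locus m V'" "V \<subseteq> V'" for V'
  proof (rule ccontr)
    assume "\<not> ?thesis"
    then have "V'' = V'" if "dense_locus m V''" "V' \<subseteq> V''" for V'' using that by blast
    with maximal[OF that] none show False by blast
  qed
  have "\<exists>C. closed_chain n C \<and> dense_locus m (C n) \<and> V \<subseteq> C n" for n
  proof (induction n)
    case 0
    show ?case using assms by (intro exI[of _ "\<lambda>_. V"]) (simp add: closed_chain_def dense_locus_def)
  next
    case (Suc n)
    then obtain C where C: "closed_chain n C" "dense_locus m (C n)" "V \<subseteq> C n" by blast
    obtain V'' where V'': "dense_locus m V''" "C n \<subset> V''" using larger[OF C(2,3)] by blast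
    have "closed_chain (Suc n) (C(Suc n := V''))"
      using closed_chain_extend[OF C(1) _ _ V''(2)] V''(1) by (simp add: dense_locus_def)
    moreover have "dense_locus m ((C(Suc n := V'')) (Suc n))" "V \<subseteq> (C(Suc n := V'')) (Suc n)"
      using V'' C(3) by auto
    ultimately show ?case by blast
  qed
  then obtain C :: "nat \<Rightarrow> ('n \<Rightarrow> 'k) set" where "closed_chain (Suc (card (UNIV :: 'n set))) C" by blast
  from closed_chain_length[OF this] show False by simp
qed

text \<open>For a maximal \<open>V'\<close>, the general point of the join \<open>J\<close> of \<open>V'\<close> and \<open>X\<close> cannot have rank \<open>m\<close> by
  maximality, nor rank \<open>m + 1\<close>, since otherwise the induction hypothesis puts \<open>J + X\<close> into a
  larger member of the family. Hence it has rank \<open>m - 1\<close>.\<close>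

lemma dense_locus_join:
  assumes "generic_rk < m" "dense_locus m V"
  shows "\<exists>J. dense_locus (m - 1) J \<and> V + X \<subseteq> J"
  using assms
proof (induction "Suc max_rank - m" arbitrary: m V rule: less_induct)
  case less
  \<comment> \<open>The measure shrinks as \<open>m\<close> grows; beyond \<open>max_rank\<close>
    the loci are empty, so there the claim is vacuous.\<close>
  have "m \<le> max_rank"
  proof (rule ccontr)
    assume "\<not> ?thesis"
    then have "rk_locus m = {}" using rk_le_max_rank by (auto simp: rk_locus_def)
    then show False using less.prems(2) by (auto simp: dense_locus_def irred_def)
  qed
  show ?case
  proof (rule dense_locus_maximal[OF less.prems(2)])
    fix V' assume V': "dense_locus m V'" "V \<subseteq> V'"
      and max: "\<And>V''. dense_locus m V'' \<Longrightarrow> V' \<subseteq> V'' \<Longrightarrow> V'' = V'"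
    have irr: "irred V'" and cl: "acl V' = V'" and dense: "V' \<subseteq> acl (V' \<inter> rk_locus m)"
      using V'(1) by (simp_all add: dense_locus_def)
    have not_closed: "\<not> V' + X \<subseteq> V'"
    proof
      assume "V' + X \<subseteq> V'"
      then have "V' = UNIV" using irr by (intro closed_under_X_imp_UNIV) (auto simp: irred_def)
      then show False using acl_rk_locus_proper[of m] less.prems(1) dense by auto
    qed
    \<comment> \<open>Only points of rank exactly \<open>m\<close> are translated, so that ranks in
      \<open>Q\<close> differ from \<open>m\<close> by at most one; by density the closure is
      nevertheless the full join of \<open>V'\<close> and \<open>X\<close>.\<close>
    define Q where "Q = (V' \<inter> rk_locus m) + X"
    define J where "J = acl Q"
    have "V' + X \<subseteq> acl (V' \<inter> rk_locus m) + acl X"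
      using dense by (rule set_plus_mono2) (rule subset_acl)
    then have VX: "V' + X \<subseteq> J" using acl_plus unfolding J_def Q_def by blast
    have "V' \<subseteq> J"
    proof
      fix v assume "v \<in> V'"
      from set_plus_intro[OF this zero_in_X] show "v \<in> J" using VX by auto
    qed
    have "Q \<subseteq> V' + X" unfolding Q_def by (rule set_plus_mono2) auto
    then have "J = acl (V' + X)" unfolding J_def using VX acl_subset_acl
      by (metis J_def acl_mono subset_antisym)
    then have "irred J" using irred_plus[OF irr irred_X] by simp
    then have "irred Q" by (simp add: J_def)
    have "acl J = J" by (simp add: J_def)
    have dense_J: "dense_locus j J" if "Q \<subseteq> acl (Q \<inter> S)" "S \<subseteq> rk_locus j" for j S
    proof -
      have "Q \<inter> S \<subseteq> J \<inter> rk_locus j" using that(2) subset_acl unfolding J_def by blast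
      then have "Q \<subseteq> acl (J \<inter> rk_locus j)" using that(1) acl_mono by blast
      then have "J \<subseteq> acl (J \<inter> rk_locus j)" unfolding J_def by (rule acl_subset_acl)
      then show ?thesis using \<open>irred J\<close> \<open>acl J = J\<close> by (simp add: dense_locus_def)
    qed
    have "Q \<subseteq> rk_locus (m - 1) \<union> (rk_locus m \<union> rk_locus (Suc m))"
    proof
      fix w assume "w \<in> Q"
      then obtain v x where "v \<in> rk_locus m" "x \<in> X" "w = v + x"
        unfolding Q_def by (blast elim: set_plus_elim)
      then show "w \<in> rk_locus (m - 1) \<union> (rk_locus m \<union> rk_locus (Suc m))"
        using rk_plus_le[of x v] by (auto simp: rk_locus_def)
    qed
    then consider "Q \<subseteq> acl (Q \<inter> rk_locus (m - 1))" | "Q \<subseteq> acl (Q \<inter> rk_locus m)"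
      | "Q \<subseteq> acl (Q \<inter> rk_locus (Suc m))"
    proof -
      assume cover: "Q \<subseteq> rk_locus (m - 1) \<union> (rk_locus m \<union> rk_locus (Suc m))"
      show thesis
      proof (cases "Q \<subseteq> acl (Q \<inter> rk_locus (m - 1))")
        case False
        define Q' where "Q' = Q \<inter> (rk_locus m \<union> rk_locus (Suc m))"
        have "Q \<subseteq> acl Q'"
          using irred_dense_in_cover[OF \<open>irred Q\<close> cover] False unfolding Q'_def by blast
        then have "acl Q' = J"
          unfolding J_def Q'_def by (metis Int_lower1 acl_mono acl_subset_acl subset_antisym)
        then have "irred Q'" using \<open>irred J\<close> by (metis irred_acl)
        moreover have "Q' \<subseteq> rk_locus m \<union> rk_locus (Suc m)" unfolding Q'_def by blast
        ultimately have "Q' \<subseteq> acl (Q' \<inter> rk_locus m) \<or> Q' \<subseteq> acl (Q' \<inter> rk_locus (Suc m))"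
          by (rule irred_dense_in_cover)
        then have "Q \<subseteq> acl (Q' \<inter> rk_locus m) \<or> Q \<subseteq> acl (Q' \<inter> rk_locus (Suc m))"
          using \<open>Q \<subseteq> acl Q'\<close> acl_subset_acl by blast
        moreover have "Q' \<inter> rk_locus j \<subseteq> Q \<inter> rk_locus j" for j unfolding Q'_def by blast
        ultimately show thesis using that(2,3) acl_mono by blast
      qed (rule that(1))
    qed
    then show ?thesis
    proof cases
      case 1
      have "dense_locus (m - 1) J" using dense_J[OF 1 subset_refl] .
      moreover have "V + X \<subseteq> V' + X" using V'(2) by (rule set_plus_mono2) simp
      ultimately show ?thesis using VX by blast
    next
      case 2
      then have "J = V'" using max[OF dense_J[OF 2 subset_refl] \<open>V' \<subseteq> J\<close>] by simp
      with VX not_closed show ?thesis by simp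
    next
      case 3
      have "\<exists>J'. dense_locus (Suc m - 1) J' \<and> J + X \<subseteq> J'"
        using less.hyps[of "Suc m" J] less.prems(1) \<open>m \<le> max_rank\<close> dense_J[OF 3 subset_refl] by simp
      then obtain J' where J': "dense_locus m J'" "J + X \<subseteq> J'" by auto
      have "J \<subseteq> J'"
      proof
        fix v assume "v \<in> J"
        from set_plus_intro[OF this zero_in_X] show "v \<in> J'" using J'(2) by auto
      qed
      then have "J' = V'" using max[OF J'(1)] \<open>V' \<subseteq> J\<close> by blast
      with \<open>J \<subseteq> J'\<close> VX not_closed show ?thesis by blast
    qed
  qed
qed

text \<open>Starting from the irreducible set \<open>{p}\<close> reaches every point of the locus,
  whatever its components are; continuity of translations then extends the inclusion to the
  closure.\<close>

lemma acl_rk_locus_plus: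
  assumes "generic_rk < m"
  shows "acl (rk_locus m) + X \<subseteq> acl (rk_locus (m - 1))"
proof -
  have "p + x \<in> acl (rk_locus (m - 1))" if p: "p \<in> rk_locus m" and x: "x \<in> X" for p x
  proof -
    have "dense_locus m {p}"
      using p by (simp add: dense_locus_def irred_singleton)
    from dense_locus_join[OF assms this] obtain J
      where J: "dense_locus (m - 1) J" "{p} + X \<subseteq> J" by blast
    have "p + x \<in> {p} + X" using x by (intro set_plus_intro) simp_all
    then have "p + x \<in> acl (J \<inter> rk_locus (m - 1))" using J by (auto simp: dense_locus_def)
    then show ?thesis using acl_mono[of "J \<inter> rk_locus (m - 1)" "rk_locus (m - 1)"] by blast
  qed
  then show ?thesis using acl_translate by (blast elim: set_plus_elim)
qed

text \<open>If \<open>Z = acl (C + line x)\<close> were the whole join \<open>J\<close> for every \<open>x\<close> that does not stabilise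
  \<open>C\<close>, then \<open>J\<close> would be stable under the translations by a dense set of such \<open>x\<close>, hence under
  all of \<open>X\<close>.\<close>

lemma join_intermediate:
  assumes C: "irred C" "acl C = C" and J: "J = acl (C + X)" "J \<noteq> UNIV"
  obtains Z where "irred Z" "acl Z = Z" "C \<subset> Z" "Z \<subset> J"
proof (rule ccontr)
  note intermediate = that
  assume none: "\<not> thesis"
  have "C \<noteq> {}" using C(1) by (simp add: irred_def)
  have CX: "C + X \<subseteq> J" unfolding J(1) by (rule subset_acl)
  have CJ: "C \<subseteq> J"
  proof
    fix v assume "v \<in> C"
    from set_plus_intro[OF this zero_in_X] show "v \<in> J" using CX by auto
  qed
  have "\<not> C + X \<subseteq> C"
    using closed_under_X_imp_UNIV[OF \<open>C \<noteq> {}\<close>] CJ J(2) by blast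
  then obtain c0 x0 where c0: "c0 \<in> C" "x0 \<in> X" "c0 + x0 \<notin> acl C"
    using C(2) by (auto elim!: set_plus_elim)
  then obtain f where f: "f \<in> polyfun" "vanishes f C" "f (c0 + x0) \<noteq> 0"
    unfolding acl_def by blast
  have f': "(\<lambda>x. f (c0 + x)) \<in> polyfun" by (rule polyfun_translate[OF f(1)])
  \<comment> \<open>The inequality certifies that translation by \<open>x\<close> moves
    \<open>c0\<close> out of \<open>C\<close>. As an open condition satisfied by \<open>x0\<close>,
    it holds on a dense part of the irreducible \<open>X\<close>.\<close>
  define D where "D = X \<inter> {x. f (c0 + x) \<noteq> 0}"
  have "X \<subseteq> acl D"
    unfolding D_def by (rule irred_dense_open[OF irred_X f']) (use c0(2) f(3) in \<open>auto simp: vanishes_def\<close>)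
  have J_D: "J + D \<subseteq> J"
  proof -
    have "v + x \<in> J" if v: "v \<in> J" and x: "x \<in> D" for v x
    proof -
      define Z where "Z = acl (C + line x)"
      have "x \<in> X" "f (c0 + x) \<noteq> 0" using x by (simp_all add: D_def)
      have "c0 + x \<in> C + line x" using c0(1) by (intro set_plus_intro) simp_all
      then have "c0 + x \<in> Z" using subset_acl unfolding Z_def by blast
      moreover have "c0 + x \<notin> C" using vanishesD[OF f(2)] \<open>f (c0 + x) \<noteq> 0\<close> by blast
      moreover have "C \<subseteq> Z"
      proof
        fix v assume "v \<in> C"
        from set_plus_intro[OF this zero_in_line] have "v \<in> C + line x" by simp
        then show "v \<in> Z" using subset_acl unfolding Z_def by blast
      qed
      ultimately have "C \<subset> Z" by blast
      have "irred Z" "acl Z = Z" unfolding Z_def using irred_plus[OF C(1) irred_line] by simp_all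
      have "line x \<subseteq> X" using scale_X[OF \<open>x \<in> X\<close>] by (auto simp: line_def)
      then have "Z \<subseteq> J" unfolding Z_def J(1) by (intro acl_mono set_plus_mono2) auto
      then have "Z = J"
        using none intermediate[OF \<open>irred Z\<close> \<open>acl Z = Z\<close> \<open>C \<subset> Z\<close>] by blast
      have step: "u + x \<in> acl (C + line x)" if u: "u \<in> C + line x" for u
      proof -
        obtain c l where cl: "c \<in> C" "l \<in> line x" "u = c + l" using u by (blast elim: set_plus_elim)
        have "c + (l + x) \<in> C + line x"
          by (rule set_plus_intro[OF cl(1) line_plus[OF cl(2) base_in_line]])
        then show ?thesis using subset_acl cl(3) by (auto simp: add.assoc)
      qed
      have "v \<in> acl (C + line x)" using v \<open>Z = J\<close> unfolding Z_def by simp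
      from acl_translate[OF step this] show ?thesis using \<open>Z = J\<close> unfolding Z_def by simp
    qed
    then show ?thesis by (blast elim: set_plus_elim)
  qed
  have "acl J = J" by (simp add: J(1))
  have "J + X \<subseteq> acl J + acl D"
    using \<open>X \<subseteq> acl D\<close> by (intro set_plus_mono2) (simp_all add: \<open>acl J = J\<close>)
  also have "\<dots> \<subseteq> acl (J + D)" by (rule acl_plus)
  also have "\<dots> \<subseteq> J" using J_D \<open>acl J = J\<close> by (rule acl_minimal)
  finally show False using closed_under_X_imp_UNIV[of J] J(2) CJ \<open>C \<noteq> {}\<close> by blast
qed

text \<open>Each descent by one in rank appends an intermediate set and the join, hence the term
  \<open>2 * k\<close>. At rank \<open>generic_rk + 1\<close> the closure of the locus is still
  proper, so the whole space gives the final 1.\<close>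

lemma closed_chain_in_rk_locus:
  assumes "closed_chain n C" "C n \<subseteq> acl (rk_locus (generic_rk + Suc k))"
  shows "n + 2 * k + 1 \<le> card (UNIV :: 'n set)"
  using assms
proof (induction k arbitrary: n C)
  case 0
  have "C n \<subset> UNIV" using acl_rk_locus_proper[of "generic_rk + Suc 0"] 0(2) by auto
  moreover have "acl (UNIV :: ('n \<Rightarrow> 'k) set) = UNIV" using subset_acl[of UNIV] by blast
  ultimately show ?case
    using closed_chain_length[OF closed_chain_extend[OF 0(1) irred_UNIV]] by simp
next
  case (Suc k)
  define m where "m = generic_rk + Suc (Suc k)"
  define J where "J = acl (C n + X)"
  have C: "irred (C n)" "acl (C n) = C n" using Suc.prems(1) by (simp_all add: closed_chain_def)
  have "C n + X \<subseteq> acl (rk_locus m) + X"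
    using Suc.prems(2) unfolding m_def by (rule set_plus_mono2) simp
  also have "\<dots> \<subseteq> acl (rk_locus (m - 1))" by (rule acl_rk_locus_plus) (simp add: m_def)
  finally have J_sub: "J \<subseteq> acl (rk_locus (generic_rk + Suc k))"
    unfolding J_def m_def by (intro acl_subset_acl) simp
  then have "J \<noteq> UNIV" using acl_rk_locus_proper[of "generic_rk + Suc k"] by auto
  show ?case
  proof (rule join_intermediate[OF C J_def \<open>J \<noteq> UNIV\<close>])
    fix Z assume Z: "irred Z" "acl Z = Z" "C n \<subset> Z" "Z \<subset> J"
    have 1: "closed_chain (Suc n) (C(Suc n := Z))" by (rule closed_chain_extend[OF Suc.prems(1) Z(1-3)])
    have "irred J" "acl J = J" unfolding J_def using irred_plus[OF C(1) irred_X] by simp_all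
    then have "closed_chain (Suc (Suc n)) (C(Suc n := Z, Suc (Suc n) := J))"
      using Z(4) by (intro closed_chain_extend[OF 1]) simp_all
    from Suc.IH[OF this] J_sub show ?thesis by simp
  qed
qed

end

subsection \<open>The projective statement\<close>

lemma secant_sum_members:
  assumes "finite J" "\<And>j. j \<in> J \<Longrightarrow> x j \<in> X"
  shows "(\<Sum>j\<in>J. x j) \<in> secant X (card J)"
  using assms by (induction J) (simp_all add: add.commute set_plus_intro)

lemma secant_obtain:
  assumes "p \<in> secant X r"
  shows "\<exists>x. (\<forall>j<r. x j \<in> X) \<and> p = (\<Sum>j<r. x j)"
  using assms
proof (induction r arbitrary: p)
  case 0
  then show ?case by simp
next
  case (Suc r)
  from Suc.prems obtain u y where uy: "u \<in> secant X r" "y \<in> X" "p = u + y"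
    by (auto elim: set_plus_elim)
  obtain x where x: "\<forall>j<r. x j \<in> X" "u = (\<Sum>j<r. x j)" using Suc.IH[OF uy(1)] by blast
  have "(\<Sum>j<r. (x(r := y)) j) = u" unfolding x(2) by (rule sum.cong) auto
  then have "p = (\<Sum>j<Suc r. (x(r := y)) j)" by (simp add: uy(3))
  moreover have "\<forall>j<Suc r. (x(r := y)) j \<in> X" using x(1) uy(2) by (auto simp: less_Suc_eq)
  ultimately show ?case by blast
qed

lemma irreducible_cone_insert_zero:
  fixes X :: "('n::finite \<Rightarrow> 'k::{alg_closed_field, field_char_0}) set"
  assumes "zirreducible X" "nondegenerate X"
  shows "irreducible_cone (insert 0 X)"
proof
  have X: "zclosed X" "X \<noteq> {}" using assms(1) by (auto simp: zirreducible_def)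
  have acl: "acl X = insert 0 X" by (rule acl_zclosed[OF X])
  show "irred (insert 0 X)" "acl (insert 0 X) = insert 0 X"
    unfolding acl[symmetric] using zirreducible_imp_irred[OF assms(1)] by simp_all
  show "(\<lambda>i. t * x i) \<in> insert 0 X" if "x \<in> insert 0 X" for x and t :: 'k
  proof (cases "x = 0 \<or> t = 0")
    case True
    then show ?thesis by (auto simp: zero_fun_def)
  next
    case False
    with that punctured_coneD[OF zclosedD(2)[OF X(1)]] show ?thesis by simp
  qed
  show "\<exists>x\<in>insert 0 X. (\<Sum>i\<in>UNIV. a i * x i) \<noteq> 0" if "a \<noteq> (\<lambda>_. 0)" for a
    using assms(2) that unfolding nondegenerate_def by blast
qed

context
  fixes X :: "('n::finite \<Rightarrow> 'k::{alg_closed_field, field_char_0}) set"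
  assumes X: "zirreducible X" "nondegenerate X"
begin

interpretation irreducible_cone "insert 0 X"
  by (rule irreducible_cone_insert_zero[OF X])

lemma in_span_of_imp_secant:
  assumes "in_span_of X r p"
  shows "p \<in> secant (insert 0 X) r"
proof -
  obtain x a where x: "\<And>j. j < r \<Longrightarrow> x j \<in> X" "p = (\<lambda>i. \<Sum>j<r. a j * x j i)"
    using assms by (auto simp: in_span_of_def)
  have "(\<Sum>j<r. (\<lambda>i. a j * x j i)) \<in> secant (insert 0 X) (card {..<r})"
    by (rule secant_sum_members) (use x(1) scale_X in auto)
  moreover have "p = (\<Sum>j<r. (\<lambda>i. a j * x j i))" by (simp add: x(2) fun_eq_iff sum_fun_apply)
  ultimately show ?thesis by simp
qed

text \<open>In a representation of minimal length no two summands are proportional, as they could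
  otherwise be merged.\<close>

lemma in_span_of_rk: "in_span_of X (rk p) p"
proof -
  define n where "n = rk p"
  obtain x where x: "\<And>j. j < n \<Longrightarrow> x j \<in> insert 0 X" "p = (\<Sum>j<n. x j)"
    using secant_obtain[OF in_secant_rk] unfolding n_def by blast
  \<comment> \<open>A zero summand would shorten the sum. This excludes the apex, which is not a
    point of \<open>X\<close>, as well as proportional summands.\<close>
  have minimal: False if "l < n" "\<And>j. j < n \<Longrightarrow> y j \<in> insert 0 X" "y l = 0" "p = (\<Sum>j<n. y j)"
    for y l
  proof -
    have "(\<Sum>j\<in>{..<n} - {l}. y j) \<in> secant (insert 0 X) (card ({..<n} - {l}))"
      by (rule secant_sum_members) (use that(2) in auto)
    moreover have "(\<Sum>j\<in>{..<n} - {l}. y j) = p"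
      using that(1,3,4) by (simp add: sum.remove[of _ l])
    ultimately have "n \<le> n - 1" using that(1) rk_le_iff[of p "n - 1"] n_def by simp
    with that(1) show False by simp
  qed
  have "x j \<in> X" if "j < n" for j
    using minimal[OF that x(1) _ x(2)] x(1)[OF that] by blast
  moreover have "\<not> proj_eq (x j) (x l)" if jl: "j < n" "l < n" "j \<noteq> l" for j l
  proof
    assume "proj_eq (x j) (x l)"
    then obtain c where c: "x j = (\<lambda>i. c * x l i)" by (auto simp: proj_eq_def)
    define y where "y = x(j := 0, l := (\<lambda>i. (1 + c) * x l i))"
    have y_in: "y i \<in> insert 0 X" if "i < n" for i
      using x(1)[OF that] scale_X[OF x(1)[OF jl(2)]] by (simp add: y_def)
    have y_jl: "y j = 0" "y l = x l + x j"
      using jl(3) by (simp_all add: y_def c fun_eq_iff distrib_right)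
    define R where "R = {..<n} - {j} - {l}"
    have split: "(\<Sum>i<n. z i) = z j + (z l + (\<Sum>i\<in>R. z i))" for z :: "nat \<Rightarrow> 'n \<Rightarrow> 'k"
      unfolding R_def using jl by (simp add: sum.remove[of _ j] sum.remove[of _ l])
    have "(\<Sum>i\<in>R. y i) = (\<Sum>i\<in>R. x i)"
      by (rule sum.cong) (auto simp: R_def y_def)
    then have "p = (\<Sum>i<n. y i)"
      unfolding split[of y] y_jl using x(2) by (simp add: split[of x] add_ac)
    with minimal[of j y] jl(1) y_in y_jl(1) show False by blast
  qed
  moreover have "p = (\<lambda>i. \<Sum>j<n. 1 * x j i)"
    using x(2) by (simp add: fun_eq_iff sum_fun_apply)
  ultimately show ?thesis
    unfolding in_span_of_def n_def[symmetric] by (intro exI[of _ x] conjI exI[of _ "\<lambda>_. 1"]) blast+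
qed

lemma rank_eq_rk: "rank X p = rk p"
  unfolding rank_def
proof (rule Least_equality)
  show "in_span_of X (rk p) p" by (rule in_span_of_rk)
  show "rk p \<le> r" if "in_span_of X r p" for r
    using in_span_of_imp_secant[OF that] by (simp add: rk_le_iff)
qed

section \<open>Agreement of the two notions of generic rank\<close>

lemma zclosure_least: "zclosed Z \<Longrightarrow> S \<subseteq> Z \<Longrightarrow> zclosure S \<subseteq> Z"
  unfolding zclosure_def by blast

lemma zclosed_pts: "zclosed (pts :: ('n \<Rightarrow> 'k) set)"
  unfolding zclosed_def pts_def by (intro exI[of _ "{}"]) simp

text \<open>The definite description calls for uniqueness too: the open set \<open>U\<close> given
  by the equation \<open>c\<close> is dense, so it meets every nonempty open set and dictates the
  constant value there.\<close>

lemma generic_rank_eq: "generic_rank X = generic_rk"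
proof (rule generic_rk_open)
  fix c :: "('n \<Rightarrow> nat) \<Rightarrow> 'k"
  assume c: "is_hpoly c" "\<not> vanishes (peval c) UNIV"
    "\<And>v. peval c v \<noteq> 0 \<Longrightarrow> rk v = generic_rk"
  define U where "U = {v. peval c v \<noteq> 0}"
  have "0 \<notin> U" using c(3)[of 0] generic_rk_pos rk_zero by (auto simp: U_def)
  then have U_pts: "U \<subseteq> pts" by (auto simp: pts_def zero_fun_def)
  have "pts - U = {v. v \<noteq> (\<lambda>_. 0) \<and> (\<forall>f\<in>{c}. peval f v = 0)}"
    by (auto simp: pts_def U_def)
  then have "zclosed (pts - U)" unfolding zclosed_def using c(1) by blast
  then have "zopen U" using U_pts by (simp add: zopen_def)
  have "U \<noteq> {}" using c(2) by (auto simp: U_def vanishes_def)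
  have "UNIV \<subseteq> acl (UNIV \<inter> U)"
    unfolding U_def by (rule irred_dense_open[OF irred_UNIV peval_polyfun c(2)])
  then have acl_U: "acl U = UNIV" by auto
  have "pts \<subseteq> Z" if Z: "zclosed Z" "U \<subseteq> Z" for Z
    using acl_mono[OF Z(2)] zclosedD(3)[OF Z(1)] unfolding acl_U
    by (auto simp: pts_def zero_fun_def)
  then have U_dense: "zclosure U = pts"
    using zclosure_least[OF zclosed_pts U_pts] by (auto simp: zclosure_def)
  show ?thesis
    unfolding generic_rank_def
  proof (rule the_equality)
    have "\<forall>p\<in>U. rank X p = generic_rk" using c(3) by (simp add: U_def rank_eq_rk)
    then show "\<exists>U. zopen U \<and> U \<noteq> {} \<and> zclosure U = pts \<and> (\<forall>p\<in>U. rank X p = generic_rk)"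
      using \<open>zopen U\<close> \<open>U \<noteq> {}\<close> U_dense by blast
  next
    fix g assume "\<exists>U. zopen U \<and> U \<noteq> {} \<and> zclosure U = pts \<and> (\<forall>p\<in>U. rank X p = g)"
    then obtain U' where U': "zopen U'" "U' \<noteq> {}" "\<And>p. p \<in> U' \<Longrightarrow> rank X p = g" by blast
    have "U \<inter> U' \<noteq> {}"
    proof
      assume "U \<inter> U' = {}"
      then have "zclosure U \<subseteq> pts - U'"
        using U'(1) U_pts by (intro zclosure_least) (auto simp: zopen_def)
      then show False using U' U_dense by (auto simp: zopen_def)
    qed
    then obtain p where p: "p \<in> U" "p \<in> U'" by blast
    have "rk p = generic_rk" using p(1) c(3) by (simp add: U_def)
    with U'(3)[OF p(2)] show "g = generic_rk" by (simp add: rank_eq_rk)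
  qed
qed

section \<open>Projective chains in the closures of the rank loci\<close>

lemma rank_locus_cone: "punctured_cone {p \<in> pts. rank X p = m}"
  by (auto simp: punctured_cone_def pts_def rank_eq_rk rk_scale fun_eq_iff)

lemma W_subset: "W X m \<subseteq> acl {p \<in> pts. rank X p = m} - {0}"
  unfolding W_def
  by (rule zclosure_subset_acl[OF rank_locus_cone]) (simp add: pts_def zero_fun_def)

lemma proj_chain_bound:
  assumes "\<And>i. i \<le> n \<Longrightarrow> zirreducible (C i) \<and> C i \<subseteq> W X (generic_rk + Suc k)"
    and "\<And>i. i < n \<Longrightarrow> C i \<subset> C (Suc i)"
  shows "n + 2 * Suc k \<le> card (UNIV :: 'n set)"
proof -
  \<comment> \<open>Prepending the apex \<open>{0}\<close> lengthens the chain by one, which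
    accounts for the shift between projective and affine dimension.\<close>
  define D where "D i = (case i of 0 \<Rightarrow> {0} | Suc j \<Rightarrow> insert 0 (C j))" for i
  have acl_C: "acl (C i) = insert 0 (C i)" "irred (C i)" "0 \<notin> C i" "C i \<noteq> {}" if "i \<le> n" for i
    using assms(1)[OF that] acl_zclosed[of "C i"] zirreducible_imp_irred[of "C i"]
      zclosedD(1)[of "C i"] by (auto simp: zirreducible_def)
  have "closed_chain (Suc n) D"
    unfolding closed_chain_def
  proof (intro conjI allI impI)
    fix i assume "i \<le> Suc n"
    then have "irred (D i) \<and> acl (D i) = D i"
    proof (cases i)
      case 0
      then show ?thesis by (simp add: D_def irred_singleton)
    next
      case (Suc j)
      then have "D i = acl (C j)" "irred (C j)" using acl_C[of j] \<open>i \<le> Suc n\<close> by (simp_all add: D_def)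
      then show ?thesis by simp
    qed
    then show "irred (D i)" "acl (D i) = D i" by simp_all
  next
    fix i assume i: "i < Suc n"
    show "D i \<subset> D (Suc i)"
    proof (cases i)
      case 0
      then show ?thesis using acl_C(3,4)[of 0] by (auto simp: D_def)
    next
      case (Suc j)
      have "insert 0 (C j) \<noteq> insert 0 (C i)"
        using assms(2)[of j] acl_C(3)[of j] acl_C(3)[of i] i Suc insert_ident[of 0 "C j" "C i"] by auto
      then show ?thesis using assms(2)[of j] i Suc by (auto simp: D_def)
    qed
  qed
  moreover have "D (Suc n) \<subseteq> acl (rk_locus (generic_rk + Suc k))"
  proof -
    have "C n \<subseteq> acl (rk_locus (generic_rk + Suc k))"
    proof -
      have "{p \<in> pts. rank X p = generic_rk + Suc k} \<subseteq> rk_locus (generic_rk + Suc k)"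
        by (auto simp: rk_locus_def rank_eq_rk)
      from acl_mono[OF this] show ?thesis using assms(1)[of n] W_subset by blast
    qed
    then have "acl (C n) \<subseteq> acl (rk_locus (generic_rk + Suc k))" by (rule acl_subset_acl)
    then show ?thesis using acl_C(1)[of n] by (simp add: D_def)
  qed
  ultimately have "Suc n + 2 * k + 1 \<le> card (UNIV :: 'n set)"
    by (rule closed_chain_in_rk_locus)
  then show ?thesis by simp
qed

text \<open>The subtraction in \<open>proj_codim\<close> truncates and \<open>Sup {}\<close> is 0 on
  the naturals, so the ambient dimension needs a lower bound of its own. The line through one vector
  of the locus gives a chain of length one, to which the general count applies.\<close>

lemma nonempty_W_bound:
  assumes "W X (generic_rk + Suc k) \<noteq> {}"
  shows "2 * Suc k \<le> card (UNIV :: 'n set)"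
proof -
  define A where "A = {p \<in> pts. rank X p = generic_rk + Suc k}"
  have "A \<noteq> {}"
  proof
    assume "A = {}"
    then have "W X (generic_rk + Suc k) \<subseteq> acl {} - {0}" using W_subset unfolding A_def by metis
    with assms show False by simp
  qed
  then obtain p where p: "p \<in> A" by blast
  then have "p \<noteq> 0" "rk p = generic_rk + Suc k" by (auto simp: A_def pts_def zero_fun_def rank_eq_rk)
  have "line p \<subseteq> acl (rk_locus (generic_rk + Suc k))"
  proof
    fix v assume "v \<in> line p"
    then obtain t where t: "v = (\<lambda>i. t * p i)" by (auto simp: line_def)
    have locus: "(\<lambda>i. s * p i) \<in> rk_locus (generic_rk + Suc k)" if "s \<noteq> 0" for s
      using rk_scale[OF that, of p] \<open>rk p = _\<close> by (simp add: rk_locus_def)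
    show "v \<in> acl (rk_locus (generic_rk + Suc k))"
    proof (cases "t = 0")
      case True
      have "punctured_cone (rk_locus (generic_rk + Suc k))"
        by (simp add: punctured_cone_def rk_locus_def rk_scale)
      moreover have "rk_locus (generic_rk + Suc k) \<noteq> {}" using locus[of 1] by auto
      ultimately have "0 \<in> acl (rk_locus (generic_rk + Suc k))" by (rule zero_in_acl_cone)
      with True show ?thesis by (simp add: t zero_fun_def)
    next
      case False
      then show ?thesis using locus subset_acl unfolding t by blast
    qed
  qed
  then have sub: "acl (line p) \<subseteq> acl (rk_locus (generic_rk + Suc k))" by (rule acl_subset_acl)
  have "{0} \<subset> acl (line p)"
    using subset_acl[of "line p"] \<open>p \<noteq> 0\<close> zero_in_line[of p] base_in_line[of p] by blast
  moreover have "closed_chain 0 (\<lambda>_. {0 :: 'n \<Rightarrow> 'k})" by (simp add: closed_chain_def irred_singleton)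
  ultimately have "closed_chain (Suc 0) ((\<lambda>_. {0})(Suc 0 := acl (line p)))"
    by (intro closed_chain_extend) (simp_all add: irred_line)
  from closed_chain_in_rk_locus[OF this] sub show ?thesis by simp
qed

lemma proj_codim_W: "proj_codim (W X (generic_rk + Suc k)) \<ge> enat (2 * k + 1)"
proof (cases "W X (generic_rk + Suc k) = {}")
  case True
  then show ?thesis by (simp add: proj_codim_def)
next
  case False
  define N where "N = {n. \<exists>C :: nat \<Rightarrow> ('n \<Rightarrow> 'k) set.
    (\<forall>i\<le>n. zirreducible (C i) \<and> C i \<subseteq> W X (generic_rk + Suc k)) \<and> (\<forall>i<n. C i \<subset> C (Suc i))}"
  have bound: "n + 2 * Suc k \<le> card (UNIV :: 'n set)" if "n \<in> N" for n
    using that proj_chain_bound unfolding N_def by blast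
  have "Sup N + 2 * Suc k \<le> card (UNIV :: 'n set)"
  proof (cases "N = {}")
    case True
    then show ?thesis using nonempty_W_bound[OF False] by (simp add: Sup_nat_def)
  next
    case ne: False
    have "Sup N \<le> card (UNIV :: 'n set) - 2 * Suc k"
      using ne by (rule cSup_least) (use bound in fastforce)
    then show ?thesis using nonempty_W_bound[OF False] by linarith
  qed
  then have "2 * k + 1 \<le> card (UNIV :: 'n set) - 1 - Sup N" by arith
  moreover have "proj_dim (W X (generic_rk + Suc k)) = Sup N" by (simp only: proj_dim_def N_def)
  ultimately show ?thesis using False by (simp add: proj_codim_def)
qed

lemma codim_high_rank:
  assumes "k \<ge> 1"
  shows "proj_codim (W X (generic_rank X + k)) \<ge> enat (2 * k - 1)"
proof -
  obtain j where "k = Suc j" using assms by (cases k) auto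
  then show ?thesis using proj_codim_W[of j] by (simp add: generic_rank_eq)
qed

end

theorem theorem3p6:
  fixes X :: "('n::finite \<Rightarrow> 'k::{alg_closed_field, field_char_0}) set"
    and k :: nat
  assumes "zirreducible X" and "nondegenerate X" and "k \<ge> 1"
  shows "proj_codim (W X (generic_rank X + k)) \<ge> enat (2 * k - 1)"
  using assms by (rule codim_high_rank)

end
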